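(* Let $(X,d)$ be an unbounded uniform space, $b\in\partial X$, $|x|:=d(b,x)$, and let $\rho:(0,\infty)\to(0,\infty)$ be a Borel measurable function with $\int_0^\infty\rho(t)\,dt<\infty$. Assume that $\rho$ is quasidecreasing and bounded. Then the space $(X,d_\rho)$ is bounded, the set $\overline X^d$ is a subset of $\overline X^{d_\rho}$, and $\overline X^{d_\rho}\setminus\overline X^d$ contains exactly one point.
   Context: $\overline X^d$ and $\overline X^{d_\rho}$ are the metric completions of $X$ with respect to $d$ and $d_\rho$, whose points are identified with equivalence classes of Cauchy sequences in $X$; the inclusion $\overline X^d\subset\overline X^{d_\rho}$ is the natural one induced by the identity map of $X$. $\partial X=\overline X^d\setminus X$. $\rho$ is quasidecreasing if there is a constant $C\ge1$ with $\rho(t)\le C\rho(s)$ whenever $0<s\le t$. A curve is a continuous map $\gamma$ from a compact interval; its length $\ell_d(\gamma)$ is the supremum of sums of consecutive distances over partitions; it is rectifiable if its length is finite. $(X,d)$ is uniform if it is locally compact, not complete, and there is $C_U\ge1$ such that any two points $x,y\in X$ can be connected by a curve $\gamma:[s,u]\to X$ with (i) $\ell_d(\gamma)\le C_Ud(x,y)$ and (ii) $\min\{\ell_d(\gamma|_{[s,t]}),\ell_d(\gamma|_{[t,u]})\}\le C_U\inf_{w\in\partial X}d(\gamma(t),w)$ for every $t\in[s,u]$. The sphericalized metric is $d_\rho(x,y)=\inf_\gamma\int_\gamma\rho(|\cdot|)\,ds$, the infimum over all curves in $X$, rectifiable with respect to $d$, with end points $x,y$; $ds$ is arc length with respect to $d$.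 *)

theory Defs
  imports "HOL-Analysis.Analysis"
begin

section \<open>Metric completion by Cauchy sequences\<close>

definition cauchy_rel :: "'a set \<Rightarrow> ('a \<Rightarrow> 'a \<Rightarrow> real) \<Rightarrow> ((nat \<Rightarrow> 'a) \<times> (nat \<Rightarrow> 'a)) set" where
  "cauchy_rel M d = {(\<sigma>, \<tau>). Metric_space.MCauchy M d \<sigma> \<and> Metric_space.MCauchy M d \<tau>
      \<and> (\<lambda>n. d (\<sigma> n) (\<tau> n)) \<longlonglongrightarrow> 0}"

definition cauchy_class :: "'a set \<Rightarrow> ('a \<Rightarrow> 'a \<Rightarrow> real) \<Rightarrow> (nat \<Rightarrow> 'a) \<Rightarrow> (nat \<Rightarrow> 'a) set" where
  "cauchy_class M d \<sigma> = cauchy_rel M d `` {\<sigma>}"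

definition mcompletion :: "'a set \<Rightarrow> ('a \<Rightarrow> 'a \<Rightarrow> real) \<Rightarrow> (nat \<Rightarrow> 'a) set set" where
  "mcompletion M d = {\<sigma>. Metric_space.MCauchy M d \<sigma>} // cauchy_rel M d"

definition mcompletion_dist ::
    "'a set \<Rightarrow> ('a \<Rightarrow> 'a \<Rightarrow> real) \<Rightarrow> (nat \<Rightarrow> 'a) set \<Rightarrow> (nat \<Rightarrow> 'a) set \<Rightarrow> real" where
  "mcompletion_dist M d P Q = (THE r. \<forall>\<sigma>\<in>P. \<forall>\<tau>\<in>Q. (\<lambda>n. d (\<sigma> n) (\<tau> n)) \<longlonglongrightarrow> r)"

text \<open>The canonical embedding of the space into its completion, by constant sequences.\<close>

definition mcompletion_point :: "'a set \<Rightarrow> ('a \<Rightarrow> 'a \<Rightarrow> real) \<Rightarrow> 'a \<Rightarrow> (nat \<Rightarrow> 'a) set" where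
  "mcompletion_point M d x = cauchy_class M d (\<lambda>n. x)"

definition mboundary :: "'a set \<Rightarrow> ('a \<Rightarrow> 'a \<Rightarrow> real) \<Rightarrow> (nat \<Rightarrow> 'a) set set" where
  "mboundary M d = mcompletion M d - mcompletion_point M d ` M"

text \<open>
  The completion with respect to \<open>d\<close> is a subset of the completion with respect to \<open>d'\<close> through
  the map \<open>\<iota>\<close>: the identity map of the space preserves Cauchy sequences, \<open>\<iota>\<close> is the map it
  induces on equivalence classes (the equation below entails that the induced map is well
  defined), and distinct points of the first completion stay distinct.
\<close>

definition natural_inclusion ::
    "'a set \<Rightarrow> ('a \<Rightarrow> 'a \<Rightarrow> real) \<Rightarrow> ('a \<Rightarrow> 'a \<Rightarrow> real) \<Rightarrow>
     ((nat \<Rightarrow> 'a) set \<Rightarrow> (nat \<Rightarrow> 'a) set) \<Rightarrow> bool" where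
  "natural_inclusion M d d' \<iota> \<longleftrightarrow>
     (\<forall>\<sigma>. Metric_space.MCauchy M d \<sigma> \<longrightarrow>
        Metric_space.MCauchy M d' \<sigma> \<and> \<iota> (cauchy_class M d \<sigma>) = cauchy_class M d' \<sigma>) \<and>
     inj_on \<iota> (mcompletion M d)"

section \<open>Curves, length and arc-length integrals\<close>

definition metric_curve ::
    "'a set \<Rightarrow> ('a \<Rightarrow> 'a \<Rightarrow> real) \<Rightarrow> (real \<Rightarrow> 'a) \<Rightarrow> real \<Rightarrow> real \<Rightarrow> bool" where
  "metric_curve M d \<gamma> s u \<longleftrightarrow>
     s \<le> u \<and> continuous_map (top_of_set {s..u}) (Metric_space.mtopology M d) \<gamma>"

definition curve_length :: "('a \<Rightarrow> 'a \<Rightarrow> real) \<Rightarrow> (real \<Rightarrow> 'a) \<Rightarrow> real \<Rightarrow> real \<Rightarrow> ennreal" where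
  "curve_length d \<gamma> s u =
     (SUP (n, p) \<in> {(n, p). p 0 = s \<and> p n = u \<and> (\<forall>i<n. p i \<le> p (Suc i))}.
        \<Sum>i<(n::nat). ennreal (d (\<gamma> (p i)) (\<gamma> (p (Suc i)))))"

definition rectifiable_curve ::
    "'a set \<Rightarrow> ('a \<Rightarrow> 'a \<Rightarrow> real) \<Rightarrow> (real \<Rightarrow> 'a) \<Rightarrow> real \<Rightarrow> real \<Rightarrow> bool" where
  "rectifiable_curve M d \<gamma> s u \<longleftrightarrow> metric_curve M d \<gamma> s u \<and> curve_length d \<gamma> s u < \<infinity>"

text \<open>
  The arc-length parametrization of a rectifiable curve.  The length of the initial piece depends
  continuously on its end, so every value between 0 and the total length is attained, and
  \<open>\<gamma>\<close> is constant on each level set; hence the choice of \<open>t\<close> does not matter.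
\<close>

definition arc_length_param ::
    "('a \<Rightarrow> 'a \<Rightarrow> real) \<Rightarrow> (real \<Rightarrow> 'a) \<Rightarrow> real \<Rightarrow> real \<Rightarrow> real \<Rightarrow> 'a" where
  "arc_length_param d \<gamma> s u r = \<gamma> (SOME t. t \<in> {s..u} \<and> curve_length d \<gamma> s t = ennreal r)"

definition curve_integral ::
    "('a \<Rightarrow> 'a \<Rightarrow> real) \<Rightarrow> ('a \<Rightarrow> ennreal) \<Rightarrow> (real \<Rightarrow> 'a) \<Rightarrow> real \<Rightarrow> real \<Rightarrow> ennreal" where
  "curve_integral d h \<gamma> s u =
     (\<integral>\<^sup>+ r \<in> {0..enn2real (curve_length d \<gamma> s u)}. h (arc_length_param d \<gamma> s u r) \<partial>lborel)"

section \<open>Uniform spaces\<close>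

definition mboundary_dist :: "'a set \<Rightarrow> ('a \<Rightarrow> 'a \<Rightarrow> real) \<Rightarrow> 'a \<Rightarrow> real" where
  "mboundary_dist M d x =
     (INF w \<in> mboundary M d. mcompletion_dist M d (mcompletion_point M d x) w)"

definition uniform_metric_space :: "'a set \<Rightarrow> ('a \<Rightarrow> 'a \<Rightarrow> real) \<Rightarrow> bool" where
  "uniform_metric_space M d \<longleftrightarrow>
     Metric_space M d \<and>
     locally_compact_space (Metric_space.mtopology M d) \<and>
     \<not> Metric_space.mcomplete M d \<and>
     (\<exists>C\<ge>1. \<forall>x\<in>M. \<forall>y\<in>M. \<exists>\<gamma> s u.
        metric_curve M d \<gamma> s u \<and> \<gamma> s = x \<and> \<gamma> u = y \<and>
        curve_length d \<gamma> s u \<le> ennreal (C * d x y) \<and>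
        (\<forall>t\<in>{s..u}. min (curve_length d \<gamma> s t) (curve_length d \<gamma> t u)
                      \<le> ennreal (C * mboundary_dist M d (\<gamma> t))))"

section \<open>Sphericalization\<close>

definition quasidecreasing :: "(real \<Rightarrow> real) \<Rightarrow> bool" where
  "quasidecreasing \<rho> \<longleftrightarrow> (\<exists>C\<ge>1. \<forall>s t. 0 < s \<and> s \<le> t \<longrightarrow> \<rho> t \<le> C * \<rho> s)"

text \<open>
  The infimum is taken in the extended nonnegative reals and then converted.  Infinity would be
  converted to 0, so whenever \<open>spherical_dist M d b \<rho>\<close> satisfies the axioms of a metric on \<open>M\<close>,
  the infimum is finite for all pairs of points of \<open>M\<close>.
\<close>

definition spherical_dist ::
    "'a set \<Rightarrow> ('a \<Rightarrow> 'a \<Rightarrow> real) \<Rightarrow> (nat \<Rightarrow> 'a) set \<Rightarrow> (real \<Rightarrow> real) \<Rightarrow> 'a \<Rightarrow> 'a \<Rightarrow> real" where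
  "spherical_dist M d b \<rho> x y = enn2real
     (INF (\<gamma>, s, u) \<in> {(\<gamma>, s, u). rectifiable_curve M d \<gamma> s u \<and> \<gamma> s = x \<and> \<gamma> u = y}.
        curve_integral d
          (\<lambda>z. ennreal (\<rho> (mcompletion_dist M d b (mcompletion_point M d z)))) \<gamma> s u)"

end

theory Submission
  imports Defs
begin

text \<open>
  Write \<open>a x\<close> for the distance of \<open>x\<close> to the boundary point \<open>b\<close>, and \<open>d'\<close> for the
  sphericalized metric.  The function \<open>a\<close> is positive, 1-Lipschitz and unbounded.  Everything rests
  on comparing \<open>d'\<close> with \<open>d\<close> in three ways.

  \<^item> A uniform curve from \<open>x\<close> to \<open>y\<close> has length at most \<open>C * d x y\<close> and \<open>\<rho>\<close> is bounded by some
    \<open>B\<close>, so \<open>d' x y \<le> B * C * d x y\<close>.  Hence \<open>d\<close>-Cauchy sequences are \<open>d'\<close>-Cauchy.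

  \<^item> Every curve from \<open>x\<close> to \<open>y\<close> has an initial piece of length \<open>\<delta> = min 1 (d x y)\<close>, on which
    \<open>a\<close> is at most \<open>a x + \<delta>\<close>.  As \<open>\<rho>\<close> is quasidecreasing, it is bounded below there, and so
    \<open>d' x y \<ge> c * min 1 (d x y)\<close> with \<open>c > 0\<close> depending only on a bound for \<open>a x\<close>
    (\<open>weighted_dist_ge\<close>).  Hence, on sets where \<open>a\<close> is bounded, \<open>d\<close> and \<open>d'\<close> have the same Cauchy
    sequences and the same null distances.

  \<^item> On a uniform curve of length \<open>L\<close>, parametrized by arc length, the point at parameter \<open>l\<close> of
    the first half satisfies \<open>a \<ge> l / C\<close> by uniformity and \<open>a \<ge> a x - l\<close> by the Lipschitz
    property, hence \<open>a \<ge> l / (2 * C) + k * a x\<close> with \<open>k = 1 / (2 * (1 + C))\<close>; the second half is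
    symmetric.  Integrating gives \<open>d' x y \<le> T (a x) + T (a y)\<close>, where \<open>T R\<close> is a multiple of the
    integral of \<open>\<rho>\<close> over the half-line from \<open>k * R\<close> (\<open>curve_integral_le_tails\<close>).  So \<open>d'\<close> is
    bounded, and any two sequences on which \<open>a\<close> tends to infinity are \<open>d'\<close>-Cauchy and equivalent:
    they define the additional point.

  A \<open>d'\<close>-Cauchy sequence on which \<open>a\<close> does not tend to infinity returns to a set where \<open>a\<close> is
  bounded; by the second comparison it stays in such a set and is \<open>d\<close>-Cauchy.  So there is no
  further new point (\<open>natural_inclusion_one_point_complement\<close>).

  What precedes these comparisons is the theory of length that they need: arc length depends
  continuously on the end point, so that the arc-length parametrization exists and is 1-Lipschitz,
  and line integrals behave well under reversal and concatenation of curves, so that \<open>d'\<close> is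
  symmetric and satisfies the triangle inequality.
\<close>

section \<open>Length of curves\<close>

definition polygon_length :: "('a \<Rightarrow> 'a \<Rightarrow> real) \<Rightarrow> (real \<Rightarrow> 'a) \<Rightarrow> nat \<Rightarrow> (nat \<Rightarrow> real) \<Rightarrow> real" where
  "polygon_length d \<gamma> n p = (\<Sum>i<n. d (\<gamma> (p i)) (\<gamma> (p (Suc i))))"

definition partition_points :: "real \<Rightarrow> real \<Rightarrow> (nat \<times> (nat \<Rightarrow> real)) set" where
  "partition_points s u = {(n, p). p 0 = s \<and> p n = u \<and> (\<forall>i<n. p i \<le> p (Suc i))}"

context Metric_space
begin

lemma curve_length_alt:
  "curve_length d \<gamma> s u = (SUP (n, p) \<in> partition_points s u. ennreal (polygon_length d \<gamma> n p))"
  by (simp add: curve_length_def partition_points_def polygon_length_def sum_ennreal)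

lemma polygon_length_nonneg [simp]: "0 \<le> polygon_length d \<gamma> n p"
  by (simp add: polygon_length_def sum_nonneg)

lemma partition_points_range:
  assumes "(n, p) \<in> partition_points s u" "i \<le> n"
  shows "p i \<in> {s..u}"
proof -
  have "p 0 \<le> p i"
    using assms(2)
  proof (induction i)
    case (Suc i)
    then have "p i \<le> p (Suc i)" using assms(1) by (auto simp: partition_points_def)
    then show ?case using Suc by simp
  qed simp
  moreover have "p i \<le> p n"
    using assms(2)
  proof (induction rule: inc_induct)
    case (step k)
    then have "p k \<le> p (Suc k)" using assms(1) by (auto simp: partition_points_def)
    then show ?case using step by simp
  qed simp
  ultimately show ?thesis using assms(1) by (auto simp: partition_points_def)
qed

lemma polygon_length_le:
  "(n, p) \<in> partition_points s u \<Longrightarrow> ennreal (polygon_length d \<gamma> n p) \<le> curve_length d \<gamma> s u"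
  unfolding curve_length_alt by (rule SUP_upper2) auto

lemma curve_length_leI:
  assumes "\<And>n p. (n, p) \<in> partition_points s u \<Longrightarrow> ennreal (polygon_length d \<gamma> n p) \<le> B"
  shows "curve_length d \<gamma> s u \<le> B"
  unfolding curve_length_alt using assms by (auto intro!: SUP_least)

lemma partition_points_nonempty: "s \<le> u \<Longrightarrow> (1, \<lambda>i. if i = 0 then s else u) \<in> partition_points s u"
  by (simp add: partition_points_def)

lemma dist_le_curve_length:
  assumes "s \<le> u"
  shows "ennreal (d (\<gamma> s) (\<gamma> u)) \<le> curve_length d \<gamma> s u"
  using polygon_length_le[OF partition_points_nonempty[OF assms], of \<gamma>]
  by (simp add: polygon_length_def)

lemma curve_length_cong:
  assumes "\<And>t. t \<in> {s..u} \<Longrightarrow> \<gamma> t = \<gamma>' t"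
  shows "curve_length d \<gamma> s u = curve_length d \<gamma>' s u"
proof -
  have "polygon_length d \<gamma> n p = polygon_length d \<gamma>' n p" if "(n, p) \<in> partition_points s u" for n p
    unfolding polygon_length_def
    by (intro sum.cong refl arg_cong2[where f = d] assms partition_points_range[OF that]) auto
  then show ?thesis
    unfolding curve_length_alt by (intro SUP_cong) auto
qed

lemma curve_length_shift:
  "curve_length d (\<lambda>t. \<gamma> (t + c)) s u = curve_length d \<gamma> (s + c) (u + c)"
proof (rule antisym)
  show "curve_length d (\<lambda>t. \<gamma> (t + c)) s u \<le> curve_length d \<gamma> (s + c) (u + c)"
  proof (rule curve_length_leI)
    fix n p assume "(n, p) \<in> partition_points s u"
    then have "(n, \<lambda>i. p i + c) \<in> partition_points (s + c) (u + c)"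
      by (auto simp: partition_points_def)
    from polygon_length_le[OF this, of \<gamma>]
    show "ennreal (polygon_length d (\<lambda>t. \<gamma> (t + c)) n p) \<le> curve_length d \<gamma> (s + c) (u + c)"
      by (simp add: polygon_length_def)
  qed
  show "curve_length d \<gamma> (s + c) (u + c) \<le> curve_length d (\<lambda>t. \<gamma> (t + c)) s u"
  proof (rule curve_length_leI)
    fix n p assume "(n, p) \<in> partition_points (s + c) (u + c)"
    then have "(n, \<lambda>i. p i - c) \<in> partition_points s u"
      by (auto simp: partition_points_def)
    from polygon_length_le[OF this, of "\<lambda>t. \<gamma> (t + c)"]
    show "ennreal (polygon_length d \<gamma> n p) \<le> curve_length d (\<lambda>t. \<gamma> (t + c)) s u"
      by (simp add: polygon_length_def)
  qed
qed

lemma curve_length_reverse_le: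
  "curve_length d \<gamma> s u \<le> curve_length d (\<lambda>t. \<gamma> (- t)) (- u) (- s)"
proof (rule curve_length_leI)
  fix n p assume p: "(n, p) \<in> partition_points s u"
  have "- p (n - i) \<le> - p (n - Suc i)" if "i < n" for i
  proof -
    have "n - Suc i < n" "Suc (n - Suc i) = n - i" using that by auto
    then show ?thesis using p by (metis (mono_tags, lifting) case_prodD mem_Collect_eq neg_le_iff_le partition_points_def)
  qed
  then have "(n, \<lambda>i. - p (n - i)) \<in> partition_points (- u) (- s)"
    using p by (auto simp: partition_points_def)
  moreover have "polygon_length d (\<lambda>t. \<gamma> (- t)) n (\<lambda>i. - p (n - i)) = polygon_length d \<gamma> n p"
    unfolding polygon_length_def
  proof (rule sum.reindex_bij_witness[of _ "\<lambda>i. n - Suc i" "\<lambda>i. n - Suc i"])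
    fix i assume "i \<in> {..<n}"
    then have "Suc (n - Suc i) = n - i" by auto
    then show "d (\<gamma> (p (n - Suc i))) (\<gamma> (p (Suc (n - Suc i)))) = d (\<gamma> (- (- p (n - i)))) (\<gamma> (- (- p (n - Suc i))))"
      by (simp add: commute)
  qed auto
  ultimately show "ennreal (polygon_length d \<gamma> n p) \<le> curve_length d (\<lambda>t. \<gamma> (- t)) (- u) (- s)"
    by (metis polygon_length_le)
qed

lemma curve_length_reverse:
  "curve_length d (\<lambda>t. \<gamma> (- t)) (- u) (- s) = curve_length d \<gamma> s u"
  using curve_length_reverse_le[of \<gamma> s u] curve_length_reverse_le[of "\<lambda>t. \<gamma> (- t)" "- u" "- s"]
  by simp

text \<open>
  Cutting all points of a partition off at \<open>t\<close>, from above and from below, yields partitions of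
  the two pieces with the same number of points; only the step that straddles \<open>t\<close> needs the triangle
  inequality.
\<close>

lemma polygon_length_split:
  assumes "\<gamma> ` {s..u} \<subseteq> M" "(n, p) \<in> partition_points s u" "t \<in> {s..u}"
  shows "polygon_length d \<gamma> n p \<le>
    polygon_length d \<gamma> n (\<lambda>i. min (p i) t) + polygon_length d \<gamma> n (\<lambda>i. max (p i) t)"
  unfolding polygon_length_def sum.distrib[symmetric]
proof (rule sum_mono)
  fix i assume "i \<in> {..<n}"
  then have r: "p i \<in> {s..u}" "p (Suc i) \<in> {s..u}"
    using partition_points_range[OF assms(2)] by auto
  then have m: "\<gamma> (p i) \<in> M" "\<gamma> (p (Suc i)) \<in> M" "\<gamma> t \<in> M"
    using assms(1,3) by auto
  have "p i \<le> p (Suc i)" using assms(2) \<open>i \<in> {..<n}\<close> by (auto simp: partition_points_def)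
  then show "d (\<gamma> (p i)) (\<gamma> (p (Suc i))) \<le> d (\<gamma> (min (p i) t)) (\<gamma> (min (p (Suc i)) t)) +
            d (\<gamma> (max (p i) t)) (\<gamma> (max (p (Suc i)) t))"
    using m triangle[of "\<gamma> (p i)" "\<gamma> t" "\<gamma> (p (Suc i))"] by (auto simp: min_def max_def)
qed

lemma partition_points_min:
  "(n, p) \<in> partition_points s u \<Longrightarrow> t \<in> {s..u} \<Longrightarrow> (n, \<lambda>i. min (p i) t) \<in> partition_points s t"
  by (auto simp: partition_points_def intro!: min.mono)

lemma partition_points_max:
  "(n, p) \<in> partition_points s u \<Longrightarrow> t \<in> {s..u} \<Longrightarrow> (n, \<lambda>i. max (p i) t) \<in> partition_points t u"
  by (auto simp: partition_points_def intro!: max.mono)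

lemma polygon_length_append:
  assumes p: "(n, p) \<in> partition_points s t" and q: "(m, q) \<in> partition_points t u"
  defines "r \<equiv> \<lambda>i. if i \<le> n then p i else q (i - n)"
  shows "(n + m, r) \<in> partition_points s u"
    and "polygon_length d \<gamma> (n + m) r = polygon_length d \<gamma> n p + polygon_length d \<gamma> m q"
proof -
  have r: "r (n + j) = q j" for j
    using p q by (auto simp: r_def partition_points_def)
  then have r_Suc: "r (Suc (n + j)) = q (Suc j)" for j
    by (metis add_Suc_right)
  have r': "r i = p i" if "i \<le> n" for i
    using that by (simp add: r_def)
  have "r i \<le> r (Suc i)" if "i < n + m" for i
  proof (cases "i < n")
    case True
    then show ?thesis using p by (simp add: r' partition_points_def)
  next
    case False
    then have "i = n + (i - n)" "i - n < m" using that by auto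
    then obtain j where "i = n + j" "j < m" by blast
    then show ?thesis using q by (simp add: r r_Suc partition_points_def)
  qed
  moreover have "r 0 = s" "r (n + m) = u"
    using p q r[of m] r'[of 0] by (auto simp: partition_points_def)
  ultimately show "(n + m, r) \<in> partition_points s u" by (simp add: partition_points_def)
  have "polygon_length d \<gamma> (n + m) r = (\<Sum>i<n. d (\<gamma> (r i)) (\<gamma> (r (Suc i)))) + (\<Sum>j<m. d (\<gamma> (r (n + j))) (\<gamma> (r (Suc (n + j)))))"
    unfolding polygon_length_def by (induction m) (auto simp: algebra_simps)
  also have "(\<Sum>i<n. d (\<gamma> (r i)) (\<gamma> (r (Suc i)))) = polygon_length d \<gamma> n p"
    unfolding polygon_length_def by (intro sum.cong) (auto simp: r')
  also have "(\<Sum>j<m. d (\<gamma> (r (n + j))) (\<gamma> (r (Suc (n + j))))) = polygon_length d \<gamma> m q"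
    unfolding polygon_length_def by (simp add: r r_Suc)
  finally show "polygon_length d \<gamma> (n + m) r = polygon_length d \<gamma> n p + polygon_length d \<gamma> m q" .
qed

lemma curve_length_add:
  assumes "\<gamma> ` {s..u} \<subseteq> M" "s \<le> t" "t \<le> u"
  shows "curve_length d \<gamma> s u = curve_length d \<gamma> s t + curve_length d \<gamma> t u"
proof (rule antisym)
  show "curve_length d \<gamma> s u \<le> curve_length d \<gamma> s t + curve_length d \<gamma> t u"
  proof (rule curve_length_leI)
    fix n p assume p: "(n, p) \<in> partition_points s u"
    have "ennreal (polygon_length d \<gamma> n p) \<le>
        ennreal (polygon_length d \<gamma> n (\<lambda>i. min (p i) t) + polygon_length d \<gamma> n (\<lambda>i. max (p i) t))"
      using polygon_length_split[OF assms(1) p, of t] assms by (intro ennreal_leI) auto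
    also have "\<dots> = ennreal (polygon_length d \<gamma> n (\<lambda>i. min (p i) t)) + ennreal (polygon_length d \<gamma> n (\<lambda>i. max (p i) t))"
      by (simp add: ennreal_plus)
    also have "\<dots> \<le> curve_length d \<gamma> s t + curve_length d \<gamma> t u"
      using assms by (intro add_mono polygon_length_le partition_points_min[OF p] partition_points_max[OF p]) auto
    finally show "ennreal (polygon_length d \<gamma> n p) \<le> curve_length d \<gamma> s t + curve_length d \<gamma> t u" .
  qed
  have ne: "partition_points s t \<noteq> {}" "partition_points t u \<noteq> {}"
    using partition_points_nonempty assms by blast+
  have "curve_length d \<gamma> s t + curve_length d \<gamma> t u
      = (SUP x \<in> partition_points s t. SUP y \<in> partition_points t u.
          ennreal (polygon_length d \<gamma> (fst x) (snd x)) + ennreal (polygon_length d \<gamma> (fst y) (snd y)))"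
    unfolding curve_length_alt case_prod_unfold
    by (subst ennreal_SUP_add_left[OF ne(1), symmetric], subst ennreal_SUP_add_right[OF ne(2), symmetric]) (rule refl)
  also have "\<dots> \<le> curve_length d \<gamma> s u"
  proof (intro SUP_least)
    fix x y assume "x \<in> partition_points s t" "y \<in> partition_points t u"
    then have x: "(fst x, snd x) \<in> partition_points s t" and y: "(fst y, snd y) \<in> partition_points t u"
      by simp_all
    show "ennreal (polygon_length d \<gamma> (fst x) (snd x)) + ennreal (polygon_length d \<gamma> (fst y) (snd y))
        \<le> curve_length d \<gamma> s u"
      using polygon_length_le[OF polygon_length_append(1)[OF x y], of \<gamma>]
      by (simp add: polygon_length_append(2)[OF x y])
  qed
  finally show "curve_length d \<gamma> s t + curve_length d \<gamma> t u \<le> curve_length d \<gamma> s u" .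
qed

end

section \<open>Arc-length parametrization\<close>

context Metric_space
begin

lemma rectifiable_curveD:
  assumes "rectifiable_curve M d \<gamma> s u"
  shows "s \<le> u" "\<gamma> ` {s..u} \<subseteq> M" "continuous_map (top_of_set {s..u}) mtopology \<gamma>"
    "curve_length d \<gamma> s u < \<infinity>"
  using assms continuous_map_image_subset_topspace[of "top_of_set {s..u}" mtopology \<gamma>]
  by (auto simp: rectifiable_curve_def metric_curve_def)

lemma curve_length_refl:
  assumes "\<gamma> s \<in> M" shows "curve_length d \<gamma> s s = 0"
proof -
  have "curve_length d \<gamma> s s \<le> 0"
  proof (rule curve_length_leI)
    fix n p assume p: "(n, p) \<in> partition_points s s"
    have "p i = s" "p (Suc i) = s" if "i < n" for i
      using partition_points_range[OF p, of i] partition_points_range[OF p, of "Suc i"] that by auto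
    then show "ennreal (polygon_length d \<gamma> n p) \<le> 0"
      using assms by (simp add: polygon_length_def)
  qed
  then show ?thesis by simp
qed

definition arc_length :: "(real \<Rightarrow> 'a) \<Rightarrow> real \<Rightarrow> real \<Rightarrow> real" where
  "arc_length \<gamma> s t = enn2real (curve_length d \<gamma> s t)"

lemma arc_length_refl:
  assumes "rectifiable_curve M d \<gamma> s u" shows "arc_length \<gamma> s s = 0"
proof -
  have "\<gamma> s \<in> M" using rectifiable_curveD(1,2)[OF assms] by auto
  then show ?thesis by (simp add: arc_length_def curve_length_refl)
qed

lemma arc_length_split:
  assumes "rectifiable_curve M d \<gamma> s u" "t \<in> {s..u}"
  shows "curve_length d \<gamma> s t = ennreal (arc_length \<gamma> s t)"
    and "curve_length d \<gamma> t u = ennreal (arc_length \<gamma> s u - arc_length \<gamma> s t)"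
    and "arc_length \<gamma> s t \<in> {0..arc_length \<gamma> s u}"
proof -
  note R = rectifiable_curveD[OF assms(1)]
  have add: "curve_length d \<gamma> s u = curve_length d \<gamma> s t + curve_length d \<gamma> t u"
    using curve_length_add[OF R(2)] assms(2) by simp
  then have fin: "curve_length d \<gamma> s t < top" "curve_length d \<gamma> t u < top"
    using R(4) by (auto simp: less_top)
  then show st: "curve_length d \<gamma> s t = ennreal (arc_length \<gamma> s t)"
    by (simp add: arc_length_def)
  have "arc_length \<gamma> s u = arc_length \<gamma> s t + enn2real (curve_length d \<gamma> t u)"
    unfolding arc_length_def add using fin by (simp add: enn2real_plus)
  then show "curve_length d \<gamma> t u = ennreal (arc_length \<gamma> s u - arc_length \<gamma> s t)"
    "arc_length \<gamma> s t \<in> {0..arc_length \<gamma> s u}"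
    using fin by (auto simp: arc_length_def)
qed

lemma rectifiable_curve_initial:
  assumes "rectifiable_curve M d \<gamma> s u" "t \<in> {s..u}"
  shows "rectifiable_curve M d \<gamma> s t"
proof -
  have "continuous_map (top_of_set {s..t}) mtopology \<gamma>"
    using continuous_map_from_subtopology_mono[OF rectifiable_curveD(3)[OF assms(1)]] assms(2) by auto
  then show ?thesis
    using assms arc_length_split(1)[OF assms] by (auto simp: rectifiable_curve_def metric_curve_def)
qed

lemma dist_le_arc_length_diff:
  assumes "rectifiable_curve M d \<gamma> s u" "s \<le> t" "t \<le> t'" "t' \<le> u"
  shows "d (\<gamma> t) (\<gamma> t') \<le> arc_length \<gamma> s t' - arc_length \<gamma> s t"
proof -
  have r: "rectifiable_curve M d \<gamma> s t'"
    using rectifiable_curve_initial assms by auto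
  have "ennreal (d (\<gamma> t) (\<gamma> t')) \<le> ennreal (arc_length \<gamma> s t' - arc_length \<gamma> s t)"
    using dist_le_curve_length[of t t' \<gamma>] arc_length_split(2)[OF r, of t] assms by auto
  moreover have "arc_length \<gamma> s t \<le> arc_length \<gamma> s t'"
    using arc_length_split(3)[OF r, of t] assms by auto
  ultimately show ?thesis by simp
qed

lemma continuous_on_polygon_length_min:
  assumes "continuous_map (top_of_set {s..u}) mtopology \<gamma>" "(n, p) \<in> partition_points s u"
  shows "continuous_on {s..u} (\<lambda>t. polygon_length d \<gamma> n (\<lambda>i. min (p i) t))"
  unfolding polygon_length_def
proof (rule continuous_on_sum)
  have c: "continuous_map (top_of_set {s..u}) mtopology (\<lambda>t. \<gamma> (min (p i) t))" if "i \<le> n" for i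
  proof -
    have "continuous_map (top_of_set {s..u}) (top_of_set {s..u}) (min (p i))"
      using partition_points_range[OF assms(2) that]
      by (auto intro!: continuous_on_min continuous_intros simp: min_le_iff_disj)
    from continuous_map_compose[OF this assms(1)] show ?thesis by (simp add: o_def)
  qed
  fix i assume "i \<in> {..<n}"
  then have "continuous_map (top_of_set {s..u}) euclidean
      (\<lambda>t. d (\<gamma> (min (p i) t)) (\<gamma> (min (p (Suc i)) t)))"
    using continuous_map_mdist[of "top_of_set {s..u}" "metric (M,d)"] c[of i] c[of "Suc i"] by simp
  then show "continuous_on {s..u} (\<lambda>t. d (\<gamma> (min (p i) t)) (\<gamma> (min (p (Suc i)) t)))"
    by simp
qed

text \<open>
  Take a partition \<open>p\<close> whose polygon is within \<open>e\<close> of the whole length \<open>L\<close>.  The polygon through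
  the points \<open>min (p i) t\<close> is at most the length up to \<open>t\<close>, the one through \<open>max (p i) t\<close> is at most
  the length from \<open>t\<close>, and the two together exceed \<open>L - e\<close>.  So the first one, which is continuous in
  \<open>t\<close>, is within \<open>e\<close> of the arc length for all \<open>t\<close> at once, and arc length is a uniform limit of
  continuous functions.
\<close>

lemma continuous_on_arc_length:
  assumes r: "rectifiable_curve M d \<gamma> s u"
  shows "continuous_on {s..u} (arc_length \<gamma> s)"
proof -
  note R = rectifiable_curveD[OF r]
  let ?L = "arc_length \<gamma> s u"
  have L: "curve_length d \<gamma> s u = ennreal ?L" using arc_length_split(1)[OF r] R(1) by auto
  have "\<exists>f. continuous_on {s..u} f \<and> (\<forall>t\<in>{s..u}. dist (f t) (arc_length \<gamma> s t) < e)" if "e > 0" for e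
  proof -
    have "\<exists>n p. (n, p) \<in> partition_points s u \<and> ?L - e < polygon_length d \<gamma> n p"
    proof (rule ccontr)
      assume "\<not> ?thesis"
      then have *: "polygon_length d \<gamma> n p \<le> ?L - e" if "(n, p) \<in> partition_points s u" for n p
        using that by force
      have "0 \<le> ?L - e"
        using *[OF partition_points_nonempty[OF R(1)]] polygon_length_nonneg order_trans by blast
      have "curve_length d \<gamma> s u \<le> ennreal (?L - e)"
        by (intro curve_length_leI ennreal_leI *)
      then show False using \<open>0 \<le> ?L - e\<close> \<open>e > 0\<close> by (simp add: L)
    qed
    then obtain n p where p: "(n, p) \<in> partition_points s u" and gt: "?L - e < polygon_length d \<gamma> n p"
      by blast
    let ?f = "\<lambda>t. polygon_length d \<gamma> n (\<lambda>i. min (p i) t)"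
    have "dist (?f t) (arc_length \<gamma> s t) < e" if t: "t \<in> {s..u}" for t
    proof -
      note A = arc_length_split[OF r t]
      have "?f t \<le> arc_length \<gamma> s t"
        using polygon_length_le[OF partition_points_min[OF p t], of \<gamma>] A by simp
      moreover have "polygon_length d \<gamma> n (\<lambda>i. max (p i) t) \<le> ?L - arc_length \<gamma> s t"
        using polygon_length_le[OF partition_points_max[OF p t], of \<gamma>] A by simp
      ultimately show ?thesis
        using polygon_length_split[OF R(2) p t] gt by (simp add: dist_real_def)
    qed
    then show ?thesis using continuous_on_polygon_length_min[OF R(3) p] by blast
  qed
  then have "\<forall>n. \<exists>f. continuous_on {s..u} f \<and> (\<forall>t\<in>{s..u}. dist (f t) (arc_length \<gamma> s t) < inverse (Suc n))"
    by simp
  then obtain f where f: "\<And>n. continuous_on {s..u} (f n)"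
    "\<And>n t. t \<in> {s..u} \<Longrightarrow> dist (f n t) (arc_length \<gamma> s t) < inverse (Suc n)"
    by metis
  have "uniform_limit {s..u} f (arc_length \<gamma> s) sequentially"
  proof (rule uniform_limitI)
    fix e :: real assume "e > 0"
    then obtain N where N: "inverse (Suc N) < e" using reals_Archimedean by blast
    have "dist (f n t) (arc_length \<gamma> s t) < e" if "n \<ge> N" "t \<in> {s..u}" for n t
    proof -
      have "inverse (real (Suc n)) \<le> inverse (real (Suc N))" using that by (intro le_imp_inverse_le) auto
      then show ?thesis using f(2)[OF that(2), of n] N by linarith
    qed
    then show "\<forall>\<^sub>F n in sequentially. \<forall>t\<in>{s..u}. dist (f n t) (arc_length \<gamma> s t) < e"
      unfolding eventually_sequentially by blast
  qed
  then show ?thesis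
    by (rule uniform_limit_theorem[rotated]) (auto simp: f)
qed

lemma arc_length_attained:
  assumes r: "rectifiable_curve M d \<gamma> s u" and l: "l \<in> {0..arc_length \<gamma> s u}"
  obtains t where "t \<in> {s..u}" "arc_length \<gamma> s t = l" "arc_length_param d \<gamma> s u l = \<gamma> t"
proof -
  note R = rectifiable_curveD[OF r]
  have "arc_length \<gamma> s s = 0"
    by (rule arc_length_refl[OF r])
  then obtain t0 where t0: "s \<le> t0" "t0 \<le> u" "arc_length \<gamma> s t0 = l"
    using IVT'[of "arc_length \<gamma> s" s l u] l R(1) continuous_on_arc_length[OF r] by auto
  define t where "t = (SOME t. t \<in> {s..u} \<and> curve_length d \<gamma> s t = ennreal l)"
  have "t \<in> {s..u} \<and> curve_length d \<gamma> s t = ennreal l"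
    unfolding t_def by (rule someI[of _ t0]) (use t0 arc_length_split(1)[OF r, of t0] in auto)
  then have "t \<in> {s..u}" "arc_length \<gamma> s t = l"
    using l by (auto simp: arc_length_def)
  then show thesis
    by (intro that[of t]) (simp_all add: arc_length_param_def t_def)
qed

text \<open>
  Two parameters with the same arc length bound a piece of length 0, on which the curve is
  constant.  So the arc-length parametrization does not depend on the parameter that the choice
  operator picks.
\<close>

lemma arc_length_param_eq:
  assumes r: "rectifiable_curve M d \<gamma> s u" and t: "t \<in> {s..u}"
  shows "arc_length_param d \<gamma> s u (arc_length \<gamma> s t) = \<gamma> t"
proof -
  obtain t' where t': "t' \<in> {s..u}" "arc_length \<gamma> s t' = arc_length \<gamma> s t"
    "arc_length_param d \<gamma> s u (arc_length \<gamma> s t) = \<gamma> t'"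
    using arc_length_attained[OF r arc_length_split(3)[OF r t]] by metis
  have "d (\<gamma> t') (\<gamma> t) \<le> 0"
    using dist_le_arc_length_diff[OF r, of t t'] dist_le_arc_length_diff[OF r, of t' t] t t'
    by (cases "t \<le> t'") (auto simp: commute)
  then have "d (\<gamma> t') (\<gamma> t) = 0" using nonneg[of "\<gamma> t'" "\<gamma> t"] by linarith
  moreover have "\<gamma> t' \<in> M" "\<gamma> t \<in> M" using rectifiable_curveD(2)[OF r] t t' by auto
  ultimately show ?thesis using t' by simp
qed

lemma arc_length_param_in_space:
  assumes "rectifiable_curve M d \<gamma> s u" "l \<in> {0..arc_length \<gamma> s u}"
  shows "arc_length_param d \<gamma> s u l \<in> M"
  using arc_length_attained[OF assms] rectifiable_curveD(2)[OF assms(1)] by (metis image_subset_iff)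

lemma arc_length_param_Lipschitz:
  assumes r: "rectifiable_curve M d \<gamma> s u" and l: "l \<in> {0..arc_length \<gamma> s u}" "l' \<in> {0..arc_length \<gamma> s u}"
  shows "d (arc_length_param d \<gamma> s u l) (arc_length_param d \<gamma> s u l') \<le> \<bar>l - l'\<bar>"
proof -
  obtain t t' where t: "t \<in> {s..u}" "arc_length \<gamma> s t = l" "arc_length_param d \<gamma> s u l = \<gamma> t"
    and t': "t' \<in> {s..u}" "arc_length \<gamma> s t' = l'" "arc_length_param d \<gamma> s u l' = \<gamma> t'"
    using arc_length_attained[OF r] l by metis
  show ?thesis
    using dist_le_arc_length_diff[OF r, of t t'] dist_le_arc_length_diff[OF r, of t' t] t t'
    by (cases "t \<le> t'") (auto simp: commute)
qed

lemma arc_length_param_endpoints: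
  assumes r: "rectifiable_curve M d \<gamma> s u"
  shows "arc_length_param d \<gamma> s u 0 = \<gamma> s" "arc_length_param d \<gamma> s u (arc_length \<gamma> s u) = \<gamma> u"
proof -
  note R = rectifiable_curveD[OF r]
  have "arc_length \<gamma> s s = 0"
    by (rule arc_length_refl[OF r])
  then show "arc_length_param d \<gamma> s u 0 = \<gamma> s"
    using arc_length_param_eq[OF r, of s] R(1) by simp
  show "arc_length_param d \<gamma> s u (arc_length \<gamma> s u) = \<gamma> u"
    using arc_length_param_eq[OF r, of u] R(1) by simp
qed

lemma dist_le_arc_length:
  "rectifiable_curve M d \<gamma> s u \<Longrightarrow> d (\<gamma> s) (\<gamma> u) \<le> arc_length \<gamma> s u"
  using dist_le_arc_length_diff[of \<gamma> s u s u] rectifiable_curveD(1) arc_length_refl by force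

end

section \<open>Line integrals and weighted distances\<close>

text \<open>
  The extended-valued infimum from which \<open>spherical_dist\<close> is obtained, for an arbitrary weight.
\<close>

definition weighted_dist ::
    "'a set \<Rightarrow> ('a \<Rightarrow> 'a \<Rightarrow> real) \<Rightarrow> ('a \<Rightarrow> ennreal) \<Rightarrow> 'a \<Rightarrow> 'a \<Rightarrow> ennreal" where
  "weighted_dist M d h x y =
     (INF (\<gamma>, s, u) \<in> {(\<gamma>, s, u). rectifiable_curve M d \<gamma> s u \<and> \<gamma> s = x \<and> \<gamma> u = y}.
        curve_integral d h \<gamma> s u)"

context Metric_space
begin

abbreviation metric_borel :: "'a measure" where
  "metric_borel \<equiv> sigma M {U. openin mtopology U}"

lemma curve_integral_alt:
  "curve_integral d h \<gamma> s u =
     (\<integral>\<^sup>+ r. h (arc_length_param d \<gamma> s u r) * indicator {0..arc_length \<gamma> s u} r \<partial>lborel)"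
  by (simp add: curve_integral_def arc_length_def)

lemma continuous_map_arc_length_param:
  assumes r: "rectifiable_curve M d \<gamma> s u"
  shows "continuous_map (top_of_set {0..arc_length \<gamma> s u}) mtopology (arc_length_param d \<gamma> s u)"
  unfolding continuous_map_to_metric
proof (intro ballI allI impI)
  fix l e assume l: "l \<in> topspace (top_of_set {0..arc_length \<gamma> s u})" and e: "(0::real) < e"
  let ?U = "{0..arc_length \<gamma> s u} \<inter> ball l e"
  have "openin (top_of_set {0..arc_length \<gamma> s u}) ?U"
    by (simp add: openin_open_Int)
  moreover have "arc_length_param d \<gamma> s u l' \<in> mball (arc_length_param d \<gamma> s u l) e" if "l' \<in> ?U" for l'
    using arc_length_param_in_space[OF r] arc_length_param_Lipschitz[OF r, of l l'] that l
    by (auto simp: dist_real_def)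
  ultimately show "\<exists>U. openin (top_of_set {0..arc_length \<gamma> s u}) U \<and> l \<in> U \<and>
      (\<forall>l'\<in>U. arc_length_param d \<gamma> s u l' \<in> mball (arc_length_param d \<gamma> s u l) e)"
    using l e by (intro exI[of _ ?U]) auto
qed

lemma measurable_continuous_map_metric_borel:
  fixes A :: "'b::topological_space set"
  assumes "continuous_map (top_of_set A) mtopology \<phi>"
  shows "\<phi> \<in> restrict_space borel A \<rightarrow>\<^sub>M metric_borel"
proof (rule measurable_measure_of)
  show "{U. openin mtopology U} \<subseteq> Pow M"
    using openin_subset by fastforce
  show "\<phi> \<in> space (restrict_space borel A) \<rightarrow> M"
    using assms by (auto simp: continuous_map_def Pi_iff space_restrict_space)
  fix U assume "U \<in> {U. openin mtopology U}"
  then have "openin (top_of_set A) {x \<in> A. \<phi> x \<in> U}"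
    using openin_continuous_map_preimage[OF assms, of U] by simp
  then obtain T where "open T" "{x \<in> A. \<phi> x \<in> U} = A \<inter> T"
    by (auto simp: openin_open)
  moreover have "\<phi> -` U \<inter> space (restrict_space borel A) = {x \<in> A. \<phi> x \<in> U}"
    by (auto simp: space_restrict_space)
  ultimately show "\<phi> -` U \<inter> space (restrict_space borel A) \<in> sets (restrict_space borel A)"
    by (auto simp: sets_restrict_space)
qed

lemma measurable_curve_integrand:
  fixes h :: "'a \<Rightarrow> ennreal"
  assumes "rectifiable_curve M d \<gamma> s u" "h \<in> borel_measurable metric_borel"
  shows "(\<lambda>r. h (arc_length_param d \<gamma> s u r) * indicator {0..arc_length \<gamma> s u} r) \<in> borel_measurable borel"
proof -
  have "h \<circ> arc_length_param d \<gamma> s u \<in> borel_measurable (restrict_space borel {0..arc_length \<gamma> s u})"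
    by (rule measurable_comp[OF measurable_continuous_map_metric_borel[OF
          continuous_map_arc_length_param[OF assms(1)]] assms(2)])
  then show ?thesis
    using borel_measurable_restrict_space_iff_ennreal[of "{0..arc_length \<gamma> s u}" borel "h \<circ> arc_length_param d \<gamma> s u"]
    by (simp add: o_def)
qed

lemma rectifiable_curve_reverse:
  assumes r: "rectifiable_curve M d \<gamma> s u"
  shows "rectifiable_curve M d (\<lambda>t. \<gamma> (- t)) (- u) (- s)"
proof -
  have "continuous_map (top_of_set {-u..-s}) (top_of_set {s..u}) uminus"
    by (auto intro!: continuous_intros)
  from continuous_map_compose[OF this rectifiable_curveD(3)[OF r]]
  have "continuous_map (top_of_set {-u..-s}) mtopology (\<lambda>t. \<gamma> (- t))"
    by (simp add: o_def)
  then show ?thesis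
    using rectifiable_curveD[OF r] by (simp add: rectifiable_curve_def metric_curve_def curve_length_reverse)
qed

text \<open>
  If \<open>\<phi>\<close> is the arc-length parametrization, that of the reversed curve is \<open>l \<mapsto> \<phi> (L - l)\<close>, and
  Lebesgue measure is invariant under this reflection.
\<close>

lemma curve_integral_reverse:
  assumes r: "rectifiable_curve M d \<gamma> s u" and h: "h \<in> borel_measurable metric_borel"
  shows "curve_integral d h (\<lambda>t. \<gamma> (- t)) (- u) (- s) = curve_integral d h \<gamma> s u"
proof -
  let ?L = "arc_length \<gamma> s u" and ?\<gamma> = "\<lambda>t. \<gamma> (- t)"
  let ?F = "\<lambda>r. h (arc_length_param d \<gamma> s u r) * indicator {0..?L} r"
  note r' = rectifiable_curve_reverse[OF r]
  have L: "arc_length ?\<gamma> (- u) (- s) = ?L"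
    by (simp add: arc_length_def curve_length_reverse)
  have eq: "arc_length_param d ?\<gamma> (- u) (- s) l = arc_length_param d \<gamma> s u (?L - l)" if "l \<in> {0..?L}" for l
  proof -
    have "?L - l \<in> {0..?L}" using that by simp
    then obtain t where t: "t \<in> {s..u}" "arc_length \<gamma> s t = ?L - l" "arc_length_param d \<gamma> s u (?L - l) = \<gamma> t"
      using arc_length_attained[OF r] by metis
    have "arc_length ?\<gamma> (- u) (- t) = l"
      using arc_length_split(2)[OF r t(1)] t that
      by (simp add: arc_length_def[of ?\<gamma>] curve_length_reverse)
    then show ?thesis
      using arc_length_param_eq[OF r', of "- t"] t by simp
  qed
  have "curve_integral d h \<gamma> s u = (\<integral>\<^sup>+ l. ?F (?L + -1 * l) \<partial>lborel)"
    unfolding curve_integral_alt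
    using nn_integral_real_affine[OF measurable_curve_integrand[OF r h], of "-1" ?L] by simp
  also have "\<dots> = curve_integral d h ?\<gamma> (- u) (- s)"
    unfolding curve_integral_alt L
    by (intro nn_integral_cong) (auto simp: eq split: split_indicator)
  finally show ?thesis by simp
qed

lemma rectifiable_curve_shift:
  assumes r: "rectifiable_curve M d \<gamma> s u"
  shows "rectifiable_curve M d (\<lambda>t. \<gamma> (t + c)) (s - c) (u - c)"
proof -
  have "continuous_map (top_of_set {s-c..u-c}) (top_of_set {s..u}) (\<lambda>t. t + c)"
    by (auto intro!: continuous_intros)
  from continuous_map_compose[OF this rectifiable_curveD(3)[OF r]]
  have "continuous_map (top_of_set {s-c..u-c}) mtopology (\<lambda>t. \<gamma> (t + c))"
    by (simp add: o_def)
  then show ?thesis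
    using rectifiable_curveD[OF r] by (simp add: rectifiable_curve_def metric_curve_def curve_length_shift)
qed

lemma curve_integral_shift:
  assumes r: "rectifiable_curve M d \<gamma> s u"
  shows "curve_integral d h (\<lambda>t. \<gamma> (t + c)) (s - c) (u - c) = curve_integral d h \<gamma> s u"
proof -
  let ?L = "arc_length \<gamma> s u" and ?\<gamma> = "\<lambda>t. \<gamma> (t + c)"
  have L: "arc_length ?\<gamma> (s - c) (t - c) = arc_length \<gamma> s t" for t
    by (simp add: arc_length_def curve_length_shift)
  have eq: "arc_length_param d ?\<gamma> (s - c) (u - c) l = arc_length_param d \<gamma> s u l" if l: "l \<in> {0..?L}" for l
  proof -
    obtain t where t: "t \<in> {s..u}" "arc_length \<gamma> s t = l" "arc_length_param d \<gamma> s u l = \<gamma> t"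
      using arc_length_attained[OF r l] by metis
    then show ?thesis
      using arc_length_param_eq[OF rectifiable_curve_shift[OF r, of c], of "t - c"] L[of t] by simp
  qed
  show ?thesis
    unfolding curve_integral_alt L
    by (intro nn_integral_cong) (auto simp: eq split: split_indicator)
qed

text \<open>
  The arc-length parametrization of a concatenation is that of the first curve, followed by that
  of the second one shifted by the first length.  The inequality between the integrals is the
  direction that the triangle inequality needs; stating only it avoids discussing the common end point,
  which is counted twice on the right-hand side.
\<close>

lemma rectifiable_curve_append:
  assumes r1: "rectifiable_curve M d \<gamma>\<^sub>1 s t" and r2: "rectifiable_curve M d \<gamma>\<^sub>2 t u"
    and eq: "\<gamma>\<^sub>1 t = \<gamma>\<^sub>2 t"
  defines "\<gamma> \<equiv> \<lambda>x. if x \<le> t then \<gamma>\<^sub>1 x else \<gamma>\<^sub>2 x"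
  shows "rectifiable_curve M d \<gamma> s u"
    and "h \<in> borel_measurable metric_borel \<Longrightarrow>
      curve_integral d h \<gamma> s u \<le> curve_integral d h \<gamma>\<^sub>1 s t + curve_integral d h \<gamma>\<^sub>2 t u"
proof -
  note R1 = rectifiable_curveD[OF r1] and R2 = rectifiable_curveD[OF r2]
  have \<gamma>2: "\<gamma> x = \<gamma>\<^sub>2 x" if "x \<ge> t" for x using that eq by (auto simp: \<gamma>_def)
  have img: "\<gamma> ` {s..u} \<subseteq> M"
  proof (intro image_subsetI)
    fix x assume "x \<in> {s..u}"
    then show "\<gamma> x \<in> M" using R1(2) R2(2) by (cases "x \<le> t") (auto simp: \<gamma>_def)
  qed
  have V1: "curve_length d \<gamma> s x = curve_length d \<gamma>\<^sub>1 s x" if "x \<le> t" for x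
    using that by (intro curve_length_cong) (auto simp: \<gamma>_def)
  have V2: "curve_length d \<gamma> t x = curve_length d \<gamma>\<^sub>2 t x" for x
    by (intro curve_length_cong) (auto simp: \<gamma>2)
  have "continuous_map (top_of_set {s..u}) mtopology \<gamma>"
    unfolding \<gamma>_def
  proof (rule continuous_map_cases_le)
    have "{x \<in> topspace (top_of_set {s..u}). x \<le> t} = {s..t}" "{x \<in> topspace (top_of_set {s..u}). t \<le> x} = {t..u}"
      using R1(1) R2(1) by auto
    then show "continuous_map (subtopology (top_of_set {s..u}) {x \<in> topspace (top_of_set {s..u}). x \<le> t}) mtopology \<gamma>\<^sub>1"
      "continuous_map (subtopology (top_of_set {s..u}) {x \<in> topspace (top_of_set {s..u}). t \<le> x}) mtopology \<gamma>\<^sub>2"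
      using R1 R2 by (auto simp: subtopology_subtopology Int_absorb1)
  qed (auto simp: eq)
  moreover have "curve_length d \<gamma> s u = curve_length d \<gamma>\<^sub>1 s t + curve_length d \<gamma>\<^sub>2 t u"
    using curve_length_add[OF img R1(1) R2(1)] V1 V2 by simp
  ultimately show r: "rectifiable_curve M d \<gamma> s u"
    using R1 R2 by (auto simp: rectifiable_curve_def metric_curve_def)
  let ?L1 = "arc_length \<gamma>\<^sub>1 s t" and ?L2 = "arc_length \<gamma>\<^sub>2 t u"
  let ?\<phi> = "arc_length_param d \<gamma> s u" and ?\<phi>1 = "arc_length_param d \<gamma>\<^sub>1 s t" and ?\<phi>2 = "arc_length_param d \<gamma>\<^sub>2 t u"
  have nn: "0 \<le> ?L1" "0 \<le> ?L2" by (simp_all add: arc_length_def)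
  have A1: "arc_length \<gamma> s x = arc_length \<gamma>\<^sub>1 s x" if "x \<le> t" for x
    using V1[OF that] by (simp add: arc_length_def)
  have A2: "arc_length \<gamma> s x = ?L1 + arc_length \<gamma>\<^sub>2 t x" if x: "x \<in> {t..u}" for x
  proof -
    have "rectifiable_curve M d \<gamma> s x" using rectifiable_curve_initial[OF r] R1(1) x by auto
    from arc_length_split(2)[OF this, of t] arc_length_split(3)[OF this, of t]
    have "arc_length \<gamma>\<^sub>2 t x = arc_length \<gamma> s x - arc_length \<gamma> s t"
      using R1(1) x by (simp add: V2 arc_length_def[of "\<gamma>\<^sub>2"])
    then show ?thesis using A1[of t] by simp
  qed
  have L: "arc_length \<gamma> s u = ?L1 + ?L2" using A2[of u] R2(1) by simp
  have \<phi>1: "?\<phi> l = ?\<phi>1 l" if l: "l \<in> {0..?L1}" for l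
  proof -
    obtain x where x: "x \<in> {s..t}" "arc_length \<gamma>\<^sub>1 s x = l" "?\<phi>1 l = \<gamma>\<^sub>1 x"
      using arc_length_attained[OF r1 l] by metis
    then show ?thesis
      using arc_length_param_eq[OF r, of x] A1[of x] R2(1) by (auto simp: \<gamma>_def)
  qed
  have \<phi>2: "?\<phi> l = ?\<phi>2 (l - ?L1)" if l: "l - ?L1 \<in> {0..?L2}" for l
  proof -
    obtain x where x: "x \<in> {t..u}" "arc_length \<gamma>\<^sub>2 t x = l - ?L1" "?\<phi>2 (l - ?L1) = \<gamma>\<^sub>2 x"
      using arc_length_attained[OF r2 l] by metis
    then show ?thesis
      using arc_length_param_eq[OF r, of x] A2[of x] R1(1) \<gamma>2[of x] by auto
  qed
  show "curve_integral d h \<gamma> s u \<le> curve_integral d h \<gamma>\<^sub>1 s t + curve_integral d h \<gamma>\<^sub>2 t u"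
    if h: "h \<in> borel_measurable metric_borel"
  proof -
    let ?F1 = "\<lambda>l. h (?\<phi>1 l) * indicator {0..?L1} l" and ?F2 = "\<lambda>l. h (?\<phi>2 l) * indicator {0..?L2} l"
    note m = measurable_curve_integrand[OF r1 h] measurable_curve_integrand[OF r2 h]
    have m2: "(\<lambda>l. ?F2 (- ?L1 + 1 * l)) \<in> borel_measurable borel"
      by (rule measurable_compose[OF _ m(2)]) simp
    have "curve_integral d h \<gamma> s u \<le> (\<integral>\<^sup>+ l. ?F1 l + ?F2 (- ?L1 + 1 * l) \<partial>lborel)"
      unfolding curve_integral_alt
    proof (rule nn_integral_mono)
      fix l
      consider "l \<in> {0..?L1}" | "l - ?L1 \<in> {0..?L2}" | "l \<notin> {0..arc_length \<gamma> s u}"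
        unfolding L by fastforce
      then show "h (?\<phi> l) * indicator {0..arc_length \<gamma> s u} l \<le> ?F1 l + ?F2 (- ?L1 + 1 * l)"
      proof cases
        case 1
        then have "l \<in> {0..arc_length \<gamma> s u}" using nn unfolding L by auto
        then show ?thesis using 1 \<phi>1[OF 1] by simp
      next
        case 2
        then have "l \<in> {0..arc_length \<gamma> s u}" using nn unfolding L by auto
        then show ?thesis using 2 \<phi>2[OF 2] by (simp add: add.commute)
      qed simp
    qed
    also have "\<dots> = (\<integral>\<^sup>+ l. ?F1 l \<partial>lborel) + (\<integral>\<^sup>+ l. ?F2 (- ?L1 + 1 * l) \<partial>lborel)"
      using m m2 by (intro nn_integral_add) auto
    also have "(\<integral>\<^sup>+ l. ?F2 (- ?L1 + 1 * l) \<partial>lborel) = (\<integral>\<^sup>+ l. ?F2 l \<partial>lborel)"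
      using nn_integral_real_affine[OF m(2), of 1 "- ?L1"] by simp
    finally show ?thesis by (simp only: curve_integral_alt)
  qed
qed

lemma weighted_dist_le:
  "rectifiable_curve M d \<gamma> s u \<Longrightarrow> weighted_dist M d h (\<gamma> s) (\<gamma> u) \<le> curve_integral d h \<gamma> s u"
  unfolding weighted_dist_def by (rule INF_lower2[of "(\<gamma>, s, u)"]) auto

lemma weighted_dist_geI:
  assumes "\<And>\<gamma> s u. rectifiable_curve M d \<gamma> s u \<Longrightarrow> \<gamma> s = x \<Longrightarrow> \<gamma> u = y \<Longrightarrow> B \<le> curve_integral d h \<gamma> s u"
  shows "B \<le> weighted_dist M d h x y"
  unfolding weighted_dist_def using assms by (auto intro!: INF_greatest)

lemma weighted_dist_refl:
  assumes "x \<in> M" shows "weighted_dist M d h x x = 0"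
proof -
  let ?\<gamma> = "\<lambda>_::real. x"
  have V: "curve_length d ?\<gamma> 0 0 = 0" using assms by (simp add: curve_length_refl)
  then have "rectifiable_curve M d ?\<gamma> 0 0"
    using assms by (simp add: rectifiable_curve_def metric_curve_def)
  from weighted_dist_le[OF this, of h] have "weighted_dist M d h x x \<le> curve_integral d h ?\<gamma> 0 0"
    by simp
  also have "\<dots> = (\<integral>\<^sup>+ (r::real). 0 \<partial>lborel)"
    unfolding curve_integral_def V
  proof (rule nn_integral_cong_AE)
    show "AE r in lborel. h (arc_length_param d ?\<gamma> 0 0 r) * indicator {0..enn2real 0} r = 0"
      using AE_lborel_singleton[of 0] by eventually_elim auto
  qed
  finally show ?thesis by simp
qed

lemma weighted_dist_commute_le:
  assumes h: "h \<in> borel_measurable metric_borel"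
  shows "weighted_dist M d h y x \<le> weighted_dist M d h x y"
proof (rule weighted_dist_geI)
  fix \<gamma> s u assume r: "rectifiable_curve M d \<gamma> s u" and e: "\<gamma> s = x" "\<gamma> u = y"
  then show "weighted_dist M d h y x \<le> curve_integral d h \<gamma> s u"
    using weighted_dist_le[OF rectifiable_curve_reverse[OF r], of h] curve_integral_reverse[OF r h] by simp
qed

lemma weighted_dist_commute:
  "h \<in> borel_measurable metric_borel \<Longrightarrow> weighted_dist M d h x y = weighted_dist M d h y x"
  by (intro antisym weighted_dist_commute_le)

lemma weighted_dist_triangle:
  assumes h: "h \<in> borel_measurable metric_borel"
  shows "weighted_dist M d h x z \<le> weighted_dist M d h x y + weighted_dist M d h y z"
proof (cases "weighted_dist M d h x y = \<infinity> \<or> weighted_dist M d h y z = \<infinity>")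
  case False
  let ?W = "weighted_dist M d h"
  have curves: "?W x z \<le> curve_integral d h \<gamma>\<^sub>1 s t + curve_integral d h \<gamma>\<^sub>2 t' u"
    if r1: "rectifiable_curve M d \<gamma>\<^sub>1 s t" "\<gamma>\<^sub>1 s = x" "\<gamma>\<^sub>1 t = y"
      and r2: "rectifiable_curve M d \<gamma>\<^sub>2 t' u" "\<gamma>\<^sub>2 t' = y" "\<gamma>\<^sub>2 u = z" for \<gamma>\<^sub>1 s t \<gamma>\<^sub>2 t' u
  proof -
    \<comment> \<open>Shift the parameter of the second curve so that it starts where the first one ends.\<close>
    let ?c = "t' - t"
    let ?\<gamma>2 = "\<lambda>x. \<gamma>\<^sub>2 (x + ?c)"
    have r2': "rectifiable_curve M d ?\<gamma>2 t (u - ?c)"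
      using rectifiable_curve_shift[OF r2(1), of ?c] by simp
    have "\<gamma>\<^sub>1 t = ?\<gamma>2 t" using that by simp
    note app = rectifiable_curve_append[OF r1(1) r2' this]
    let ?\<gamma> = "\<lambda>x. if x \<le> t then \<gamma>\<^sub>1 x else ?\<gamma>2 x"
    have "s \<le> t" "t' \<le> u" using rectifiable_curveD(1) r1 r2 by auto
    then have "?\<gamma> s = x" "?\<gamma> (u - ?c) = z" using that by auto
    then have "?W x z \<le> curve_integral d h ?\<gamma> s (u - ?c)"
      using weighted_dist_le[OF app(1), of h] by simp
    also have "\<dots> \<le> curve_integral d h \<gamma>\<^sub>1 s t + curve_integral d h ?\<gamma>2 t (u - ?c)"
      by (rule app(2)[OF h])
    also have "curve_integral d h ?\<gamma>2 t (u - ?c) = curve_integral d h \<gamma>\<^sub>2 t' u"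
      using curve_integral_shift[OF r2(1), of h ?c] by simp
    finally show ?thesis .
  qed
  \<comment> \<open>Passing to the infimum over one curve at a time: the other summand is finite and can be moved to
    the left-hand side, so that only lower bounds of infima are involved.\<close>
  have "?W x z - ?W y z \<le> ?W x y"
  proof (rule weighted_dist_geI)
    fix \<gamma>\<^sub>1 s t assume r1: "rectifiable_curve M d \<gamma>\<^sub>1 s t" "\<gamma>\<^sub>1 s = x" "\<gamma>\<^sub>1 t = y"
    show "?W x z - ?W y z \<le> curve_integral d h \<gamma>\<^sub>1 s t"
    proof (cases "curve_integral d h \<gamma>\<^sub>1 s t = \<infinity>")
      case fin: False
      have "?W x z - curve_integral d h \<gamma>\<^sub>1 s t \<le> ?W y z"
        by (rule weighted_dist_geI) (use fin curves[OF r1] in \<open>auto simp: ennreal_minus_le_iff\<close>)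
      then show ?thesis
        using fin False by (auto simp: ennreal_minus_le_iff add.commute)
    qed simp
  qed
  then show ?thesis using False by (auto simp: ennreal_minus_le_iff add.commute)
qed auto

end

section \<open>Completions\<close>

context Metric_space
begin

lemma dist_diff_le:
  "x \<in> M \<Longrightarrow> y \<in> M \<Longrightarrow> x' \<in> M \<Longrightarrow> y' \<in> M \<Longrightarrow> \<bar>d x y - d x' y'\<bar> \<le> d x x' + d y y'"
  using triangle[of x x' y] triangle[of x' y' y] triangle[of x' x y'] triangle[of x y y']
  by (simp add: commute)

lemma MCauchy_in_space: "MCauchy \<sigma> \<Longrightarrow> \<sigma> n \<in> M"
  by (auto simp: MCauchy_def)

lemma convergent_dist_MCauchy:
  assumes "MCauchy \<sigma>" "MCauchy \<tau>"
  shows "convergent (\<lambda>n. d (\<sigma> n) (\<tau> n))"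
proof -
  have "\<exists>N. \<forall>m\<ge>N. \<forall>n\<ge>N. dist (d (\<sigma> m) (\<tau> m)) (d (\<sigma> n) (\<tau> n)) < e" if "e > 0" for e
  proof -
    obtain N1 where N1: "\<And>m n. N1 \<le> m \<Longrightarrow> N1 \<le> n \<Longrightarrow> d (\<sigma> m) (\<sigma> n) < e / 2"
      using assms(1) \<open>e > 0\<close> by (metis MCauchy_def half_gt_zero)
    obtain N2 where N2: "\<And>m n. N2 \<le> m \<Longrightarrow> N2 \<le> n \<Longrightarrow> d (\<tau> m) (\<tau> n) < e / 2"
      using assms(2) \<open>e > 0\<close> by (metis MCauchy_def half_gt_zero)
    have "dist (d (\<sigma> m) (\<tau> m)) (d (\<sigma> n) (\<tau> n)) < e" if "m \<ge> max N1 N2" "n \<ge> max N1 N2" for m n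
      using dist_diff_le[of "\<sigma> m" "\<tau> m" "\<sigma> n" "\<tau> n"] MCauchy_in_space[OF assms(1)] MCauchy_in_space[OF assms(2)]
        N1[of m n] N2[of m n] that by (simp add: dist_real_def)
    then show ?thesis by blast
  qed
  then show ?thesis
    by (simp add: Cauchy_convergent_iff[symmetric] Cauchy_def)
qed

lemma cauchy_rel_iff:
  "(\<sigma>, \<tau>) \<in> cauchy_rel M d \<longleftrightarrow> MCauchy \<sigma> \<and> MCauchy \<tau> \<and> (\<lambda>n. d (\<sigma> n) (\<tau> n)) \<longlonglongrightarrow> 0"
  by (simp add: cauchy_rel_def)

lemma equiv_cauchy_rel: "equiv {\<sigma>. MCauchy \<sigma>} (cauchy_rel M d)"
proof (rule equivI)
  show "cauchy_rel M d \<subseteq> {\<sigma>. MCauchy \<sigma>} \<times> {\<sigma>. MCauchy \<sigma>}"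
    by (auto simp: cauchy_rel_iff)
  show "refl_on {\<sigma>. MCauchy \<sigma>} (cauchy_rel M d)"
    by (auto simp: refl_on_def cauchy_rel_iff MCauchy_in_space)
  show "sym (cauchy_rel M d)"
    by (auto simp: sym_def cauchy_rel_iff commute)
  show "trans (cauchy_rel M d)"
  proof (rule transI)
    fix \<sigma> \<tau> \<upsilon> assume a: "(\<sigma>, \<tau>) \<in> cauchy_rel M d" "(\<tau>, \<upsilon>) \<in> cauchy_rel M d"
    then have "(\<lambda>n. d (\<sigma> n) (\<tau> n) + d (\<tau> n) (\<upsilon> n)) \<longlonglongrightarrow> 0"
      unfolding cauchy_rel_iff by (auto intro: tendsto_add_zero)
    then have "(\<lambda>n. d (\<sigma> n) (\<upsilon> n)) \<longlonglongrightarrow> 0"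
      by (rule Lim_null_comparison[rotated])
        (use a in \<open>auto simp: cauchy_rel_iff intro!: eventuallyI triangle MCauchy_in_space\<close>)
    then show "(\<sigma>, \<upsilon>) \<in> cauchy_rel M d" using a by (simp add: cauchy_rel_iff)
  qed
qed

lemma cauchy_class_self: "MCauchy \<sigma> \<Longrightarrow> \<sigma> \<in> cauchy_class M d \<sigma>"
  unfolding cauchy_class_def by (rule equiv_class_self[OF equiv_cauchy_rel]) simp

lemma cauchy_class_eq_iff:
  "MCauchy \<sigma> \<Longrightarrow> MCauchy \<tau> \<Longrightarrow>
    cauchy_class M d \<sigma> = cauchy_class M d \<tau> \<longleftrightarrow> (\<lambda>n. d (\<sigma> n) (\<tau> n)) \<longlonglongrightarrow> 0"
  unfolding cauchy_class_def using eq_equiv_class_iff[OF equiv_cauchy_rel] by (simp add: cauchy_rel_iff)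

lemma mcompletion_eq: "mcompletion M d = cauchy_class M d ` {\<sigma>. MCauchy \<sigma>}"
  by (auto simp: mcompletion_def quotient_def cauchy_class_def)

lemma tendsto_mcompletion_dist:
  assumes "MCauchy \<sigma>" "MCauchy \<tau>"
  shows "(\<lambda>n. d (\<sigma> n) (\<tau> n)) \<longlonglongrightarrow> mcompletion_dist M d (cauchy_class M d \<sigma>) (cauchy_class M d \<tau>)"
proof -
  obtain r where r: "(\<lambda>n. d (\<sigma> n) (\<tau> n)) \<longlonglongrightarrow> r"
    using convergent_dist_MCauchy[OF assms] by (auto simp: convergent_def)
  have all: "(\<lambda>n. d (\<sigma>' n) (\<tau>' n)) \<longlonglongrightarrow> r"
    if "\<sigma>' \<in> cauchy_class M d \<sigma>" "\<tau>' \<in> cauchy_class M d \<tau>" for \<sigma>' \<tau>'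
  proof -
    have \<sigma>': "MCauchy \<sigma>'" "(\<lambda>n. d (\<sigma> n) (\<sigma>' n)) \<longlonglongrightarrow> 0" and \<tau>': "MCauchy \<tau>'" "(\<lambda>n. d (\<tau> n) (\<tau>' n)) \<longlonglongrightarrow> 0"
      using that by (auto simp: cauchy_class_def cauchy_rel_iff)
    have "(\<lambda>n. d (\<sigma> n) (\<sigma>' n) + d (\<tau> n) (\<tau>' n)) \<longlonglongrightarrow> 0"
      using \<sigma>' \<tau>' by (auto intro: tendsto_add_zero)
    then have "(\<lambda>n. d (\<sigma> n) (\<tau> n) - d (\<sigma>' n) (\<tau>' n)) \<longlonglongrightarrow> 0"
      by (rule Lim_null_comparison[rotated])
        (use assms \<sigma>' \<tau>' in \<open>auto intro!: eventuallyI dist_diff_le MCauchy_in_space\<close>)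
    then show ?thesis using Lim_transform[OF r] by (auto simp: tendsto_minus_cancel_left[symmetric] intro: Lim_transform2[OF r])
  qed
  have "mcompletion_dist M d (cauchy_class M d \<sigma>) (cauchy_class M d \<tau>) = r"
    unfolding mcompletion_dist_def
  proof (rule the_equality)
    fix r' assume "\<forall>\<sigma>'\<in>cauchy_class M d \<sigma>. \<forall>\<tau>'\<in>cauchy_class M d \<tau>. (\<lambda>n. d (\<sigma>' n) (\<tau>' n)) \<longlonglongrightarrow> r'"
    then show "r' = r" using r LIMSEQ_unique assms cauchy_class_self by blast
  qed (use all in blast)
  then show ?thesis using r by simp
qed

lemma mcompletion_dist_commute:
  assumes "P \<in> mcompletion M d" "Q \<in> mcompletion M d"
  shows "mcompletion_dist M d P Q = mcompletion_dist M d Q P"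
proof -
  obtain \<sigma> \<tau> where "MCauchy \<sigma>" "MCauchy \<tau>" "P = cauchy_class M d \<sigma>" "Q = cauchy_class M d \<tau>"
    using assms by (auto simp: mcompletion_eq)
  then show ?thesis
    using tendsto_mcompletion_dist[of \<sigma> \<tau>] tendsto_mcompletion_dist[of \<tau> \<sigma>]
    by (auto simp: commute intro: LIMSEQ_unique)
qed

lemma mcompletion_dist_nonneg:
  assumes "P \<in> mcompletion M d" "Q \<in> mcompletion M d"
  shows "0 \<le> mcompletion_dist M d P Q"
proof -
  obtain \<sigma> \<tau> where "MCauchy \<sigma>" "MCauchy \<tau>" "P = cauchy_class M d \<sigma>" "Q = cauchy_class M d \<tau>"
    using assms by (auto simp: mcompletion_eq)
  then show ?thesis
    using tendsto_mcompletion_dist[of \<sigma> \<tau>] by (auto intro: LIMSEQ_le_const)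
qed

lemma mcompletion_point_in: "x \<in> M \<Longrightarrow> mcompletion_point M d x \<in> mcompletion M d"
  by (auto simp: mcompletion_eq mcompletion_point_def)

text \<open>
  With \<open>\<beta>\<close> a Cauchy sequence representing \<open>b\<close>, \<open>a x\<close> is the limit of \<open>d (\<beta> n) x\<close>, so the
  inequalities pass to the limit from the triangle inequality.  Positivity holds because \<open>b\<close> is not
  the class of a constant sequence.
\<close>

lemma dist_from_boundary_point:
  assumes b: "b \<in> mboundary M d"
  defines "a \<equiv> \<lambda>x. mcompletion_dist M d b (mcompletion_point M d x)"
  shows "\<And>x. x \<in> M \<Longrightarrow> 0 < a x"
    and "\<And>x y. x \<in> M \<Longrightarrow> y \<in> M \<Longrightarrow> \<bar>a x - a y\<bar> \<le> d x y"
    and "\<And>x y. x \<in> M \<Longrightarrow> y \<in> M \<Longrightarrow> d x y \<le> a x + a y"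
    and "\<And>x. x \<in> M \<Longrightarrow> mboundary_dist M d x \<le> a x"
proof -
  obtain \<beta> where \<beta>: "MCauchy \<beta>" "b = cauchy_class M d \<beta>"
    using b by (auto simp: mboundary_def mcompletion_eq)
  have lim: "(\<lambda>n. d (\<beta> n) x) \<longlonglongrightarrow> a x" if "x \<in> M" for x
    using tendsto_mcompletion_dist[OF \<beta>(1), of "\<lambda>_. x"] that
    by (simp add: a_def mcompletion_point_def \<beta>(2))
  note in_M = MCauchy_in_space[OF \<beta>(1)]
  fix x assume x: "x \<in> M"
  show "0 < a x"
  proof (rule ccontr)
    assume "\<not> 0 < a x"
    moreover have "0 \<le> a x" using LIMSEQ_le_const[OF lim[OF x]] by auto
    ultimately have "(\<lambda>n. d (\<beta> n) x) \<longlonglongrightarrow> 0" using lim[OF x] by simp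
    then have "b = mcompletion_point M d x"
      using \<beta> x cauchy_class_eq_iff[OF \<beta>(1), of "\<lambda>_. x"] by (simp add: mcompletion_point_def)
    then show False using b x by (simp add: mboundary_def)
  qed
  show "mboundary_dist M d x \<le> a x"
  proof -
    have "bdd_below ((\<lambda>w. mcompletion_dist M d (mcompletion_point M d x) w) ` mboundary M d)"
      using mcompletion_dist_nonneg[OF mcompletion_point_in[OF x]]
      by (intro bdd_belowI[of _ 0]) (auto simp: mboundary_def)
    from cINF_lower[OF this b] show ?thesis
      unfolding mboundary_dist_def a_def
      using mcompletion_dist_commute[of b "mcompletion_point M d x"] mcompletion_point_in[OF x] b
      by (simp add: mboundary_def)
  qed
  fix y assume y: "y \<in> M"
  have "(\<lambda>n. \<bar>d (\<beta> n) x - d (\<beta> n) y\<bar>) \<longlonglongrightarrow> \<bar>a x - a y\<bar>"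
    by (intro tendsto_intros lim x y)
  moreover have "\<forall>n. \<bar>d (\<beta> n) x - d (\<beta> n) y\<bar> \<le> d x y"
    using dist_diff_le[OF in_M x in_M y] in_M by (metis add_0 mdist_zero)
  ultimately show "\<bar>a x - a y\<bar> \<le> d x y"
    using LIMSEQ_le_const2 by blast
  have "(\<lambda>n. d (\<beta> n) x + d (\<beta> n) y) \<longlonglongrightarrow> a x + a y"
    by (intro tendsto_intros lim x y)
  then show "d x y \<le> a x + a y"
    by (rule LIMSEQ_le_const) (use triangle''[OF x in_M y] in auto)
qed

end

text \<open>
  The topological core, freed from curves: \<open>d'\<close> is dominated by \<open>d\<close>, controls \<open>d\<close> from below
  wherever the size function \<open>a\<close> is bounded, and shrinks to 0 where \<open>a\<close> is large.  A \<open>d'\<close>-Cauchy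
  sequence is then either \<open>d\<close>-Cauchy or escapes to infinity, and all escaping sequences are
  equivalent.
\<close>

lemma natural_inclusion_one_point_complement:
  fixes d d' :: "'a \<Rightarrow> 'a \<Rightarrow> real" and a T :: "_ \<Rightarrow> real"
  assumes "Metric_space M d" "Metric_space M d'"
    and upper: "0 < K" "\<And>x y. x \<in> M \<Longrightarrow> y \<in> M \<Longrightarrow> d' x y \<le> K * d x y"
    and lower: "\<And>R. \<exists>c>0. \<forall>x\<in>M. \<forall>y\<in>M. a x \<le> R \<longrightarrow> c * min 1 (d x y) \<le> d' x y"
    and tail: "\<And>x y. x \<in> M \<Longrightarrow> y \<in> M \<Longrightarrow> d' x y \<le> T (a x) + T (a y)" "(T \<longlongrightarrow> 0) at_top"
    and a: "\<And>x y. x \<in> M \<Longrightarrow> y \<in> M \<Longrightarrow> \<bar>a x - a y\<bar> \<le> d x y" "\<And>R. \<exists>x\<in>M. R < a x"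
  shows "\<exists>\<iota>. natural_inclusion M d d' \<iota> \<and> (\<exists>!p. p \<in> mcompletion M d' - \<iota> ` mcompletion M d)"
proof -
  interpret X: Metric_space M d by fact
  interpret Y: Metric_space M d' by fact
  have null: "(\<lambda>n. d' (\<sigma> n) (\<tau> n)) \<longlonglongrightarrow> 0"
    if "(\<lambda>n. d (\<sigma> n) (\<tau> n)) \<longlonglongrightarrow> 0" "\<And>n. \<sigma> n \<in> M" "\<And>n. \<tau> n \<in> M" for \<sigma> \<tau>
  proof (rule Lim_null_comparison)
    show "(\<lambda>n. K * d (\<sigma> n) (\<tau> n)) \<longlonglongrightarrow> 0" using tendsto_mult_right_zero[OF that(1)] by simp
    show "\<forall>\<^sub>F n in sequentially. norm (d' (\<sigma> n) (\<tau> n)) \<le> K * d (\<sigma> n) (\<tau> n)"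
      using upper(2) that by simp
  qed
  have cauchy: "Y.MCauchy \<sigma>" if \<sigma>: "X.MCauchy \<sigma>" for \<sigma>
    unfolding Y.MCauchy_def
  proof (intro conjI allI impI)
    show "range \<sigma> \<subseteq> M" using \<sigma> by (simp add: X.MCauchy_def)
    fix e :: real assume "e > 0"
    then have "e / K > 0" using upper(1) by simp
    then obtain N where N: "\<And>n n'. N \<le> n \<Longrightarrow> N \<le> n' \<Longrightarrow> d (\<sigma> n) (\<sigma> n') < e / K"
      using \<sigma> unfolding X.MCauchy_def by blast
    have "d' (\<sigma> n) (\<sigma> n') < e" if "N \<le> n" "N \<le> n'" for n n'
    proof -
      have "d' (\<sigma> n) (\<sigma> n') \<le> K * d (\<sigma> n) (\<sigma> n')"
        using upper(2) X.MCauchy_in_space[OF \<sigma>] by simp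
      also have "\<dots> < e" using N[OF that] upper(1) by (simp add: pos_less_divide_eq mult.commute)
      finally show ?thesis .
    qed
    then show "\<exists>N. \<forall>n n'. N \<le> n \<longrightarrow> N \<le> n' \<longrightarrow> d' (\<sigma> n) (\<sigma> n') < e" by blast
  qed
  have dist_less: "d x y < e"
    if "x \<in> M" "y \<in> M" "a x \<le> R" "c > 0" "\<forall>x\<in>M. \<forall>y\<in>M. a x \<le> R \<longrightarrow> c * min 1 (d x y) \<le> d' x y"
      "d' x y < c * min 1 e" for x y e R c
  proof -
    have "c * min 1 (d x y) \<le> d' x y" using that by blast
    then have "c * min 1 (d x y) < c * min 1 e" using that by linarith
    then show ?thesis using \<open>c > 0\<close> by (auto simp: min_def split: if_splits)
  qed
  have null_back: "(\<lambda>n. d (\<sigma> n) (\<tau> n)) \<longlonglongrightarrow> 0"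
    if lim: "(\<lambda>n. d' (\<sigma> n) (\<tau> n)) \<longlonglongrightarrow> 0" and M: "\<And>n. \<sigma> n \<in> M" "\<And>n. \<tau> n \<in> M"
      and bd: "\<forall>\<^sub>F n in sequentially. a (\<sigma> n) \<le> R" for \<sigma> \<tau> R
  proof -
    obtain c where c: "c > 0" "\<forall>x\<in>M. \<forall>y\<in>M. a x \<le> R \<longrightarrow> c * min 1 (d x y) \<le> d' x y"
      using lower by blast
    show ?thesis
    proof (rule tendstoI)
      fix e :: real assume "e > 0"
      then have "c * min 1 e > 0" using c by simp
      from tendstoD[OF lim this] bd show "\<forall>\<^sub>F n in sequentially. dist (d (\<sigma> n) (\<tau> n)) 0 < e"
      proof eventually_elim
        case (elim n)
        then show ?case using dist_less[of "\<sigma> n" "\<tau> n" R c e] c M by simp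
      qed
    qed
  qed
  have bounded: "\<exists>R. \<forall>\<^sub>F n in sequentially. a (\<sigma> n) \<le> R" if \<sigma>: "X.MCauchy \<sigma>" for \<sigma>
  proof -
    obtain N where N: "\<And>n n'. N \<le> n \<Longrightarrow> N \<le> n' \<Longrightarrow> d (\<sigma> n) (\<sigma> n') < 1"
      using \<sigma> unfolding X.MCauchy_def by (meson zero_less_one)
    have "a (\<sigma> n) \<le> a (\<sigma> N) + 1" if "n \<ge> N" for n
      using a(1)[of "\<sigma> n" "\<sigma> N"] N[of n N] X.MCauchy_in_space[OF \<sigma>] that by fastforce
    then show ?thesis unfolding eventually_sequentially by blast
  qed
  have T_small: "\<forall>\<^sub>F n in sequentially. T (a (\<sigma> n)) < e"
    if "filterlim (\<lambda>n. a (\<sigma> n)) at_top sequentially" "e > 0" for \<sigma> :: "nat \<Rightarrow> 'a" and e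
    using tendstoD[OF filterlim_compose[OF tail(2) that(1)] that(2)]
    by eventually_elim (simp add: dist_real_def)
  have cauchy_infinity: "Y.MCauchy \<sigma>"
    if inf: "filterlim (\<lambda>n. a (\<sigma> n)) at_top sequentially" and M: "\<And>n. \<sigma> n \<in> M" for \<sigma>
    unfolding Y.MCauchy_def
  proof (intro conjI allI impI)
    show "range \<sigma> \<subseteq> M" using M by auto
    fix e :: real assume "e > 0"
    then obtain N where N: "\<And>n. n \<ge> N \<Longrightarrow> T (a (\<sigma> n)) < e / 2"
      using T_small[OF inf, of "e/2"] by (auto simp: eventually_sequentially)
    have "d' (\<sigma> n) (\<sigma> n') < e" if "N \<le> n" "N \<le> n'" for n n'
      using tail(1)[OF M[of n] M[of n']] N[OF that(1)] N[OF that(2)] by simp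
    then show "\<exists>N. \<forall>n n'. N \<le> n \<longrightarrow> N \<le> n' \<longrightarrow> d' (\<sigma> n) (\<sigma> n') < e" by blast
  qed
  have equiv_infinity: "(\<lambda>n. d' (\<sigma> n) (\<tau> n)) \<longlonglongrightarrow> 0"
    if inf: "filterlim (\<lambda>n. a (\<sigma> n)) at_top sequentially" "filterlim (\<lambda>n. a (\<tau> n)) at_top sequentially"
      and M: "\<And>n. \<sigma> n \<in> M" "\<And>n. \<tau> n \<in> M" for \<sigma> \<tau>
  proof (rule Lim_null_comparison)
    show "\<forall>\<^sub>F n in sequentially. norm (d' (\<sigma> n) (\<tau> n)) \<le> T (a (\<sigma> n)) + T (a (\<tau> n))"
      using tail(1) M by simp
    show "(\<lambda>n. T (a (\<sigma> n)) + T (a (\<tau> n))) \<longlonglongrightarrow> 0"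
      by (intro tendsto_add_zero filterlim_compose[OF tail(2)] inf)
  qed
  \<comment> \<open>If the sequence does not escape, some term far out has bounded size; all later terms lie within
    d-distance 1 of it, hence have bounded size too, and there d' controls d.\<close>
  have dichotomy: "filterlim (\<lambda>n. a (\<sigma> n)) at_top sequentially"
    if \<sigma>: "Y.MCauchy \<sigma>" "\<not> X.MCauchy \<sigma>" for \<sigma>
  proof (rule ccontr)
    assume "\<not> ?thesis"
    then obtain R where R: "\<And>N. \<exists>n\<ge>N. a (\<sigma> n) < R"
      by (auto simp: filterlim_at_top eventually_sequentially not_le)
    note M = Y.MCauchy_in_space[OF \<sigma>(1)]
    obtain c where c: "c > 0" "\<forall>x\<in>M. \<forall>y\<in>M. a x \<le> R \<longrightarrow> c * min 1 (d x y) \<le> d' x y"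
      using lower by blast
    obtain N where N: "\<And>n n'. N \<le> n \<Longrightarrow> N \<le> n' \<Longrightarrow> d' (\<sigma> n) (\<sigma> n') < c"
      using \<sigma>(1) \<open>c > 0\<close> unfolding Y.MCauchy_def by blast
    obtain n0 where n0: "n0 \<ge> N" "a (\<sigma> n0) < R" using R by blast
    have bd: "a (\<sigma> m) \<le> R + 1" if "m \<ge> N" for m
    proof -
      have "d (\<sigma> n0) (\<sigma> m) < 1"
        using dist_less[of "\<sigma> n0" "\<sigma> m" R c 1] c M N[OF n0(1) that] n0(2) by simp
      then show ?thesis using a(1)[of "\<sigma> n0" "\<sigma> m"] M n0(2) by fastforce
    qed
    obtain c' where c': "c' > 0" "\<forall>x\<in>M. \<forall>y\<in>M. a x \<le> R + 1 \<longrightarrow> c' * min 1 (d x y) \<le> d' x y"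
      using lower by blast
    have "X.MCauchy \<sigma>"
      unfolding X.MCauchy_def
    proof (intro conjI allI impI)
      show "range \<sigma> \<subseteq> M" using M by auto
      fix e :: real assume "e > 0"
      then have "c' * min 1 e > 0" using c' by simp
      then obtain N' where N': "\<And>n n'. N' \<le> n \<Longrightarrow> N' \<le> n' \<Longrightarrow> d' (\<sigma> n) (\<sigma> n') < c' * min 1 e"
        using \<sigma>(1) unfolding Y.MCauchy_def by blast
      have "d (\<sigma> n) (\<sigma> n') < e" if "max N N' \<le> n" "max N N' \<le> n'" for n n'
        using dist_less[OF M M bd c' N', of n n'] that by simp
      then show "\<exists>N. \<forall>n n'. N \<le> n \<longrightarrow> N \<le> n' \<longrightarrow> d (\<sigma> n) (\<sigma> n') < e" by blast
    qed
    then show False using \<sigma>(2) by simp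
  qed
  \<comment> \<open>The induced map sends a class to the class of any representative.\<close>
  define \<iota> where "\<iota> P = cauchy_class M d' (SOME \<sigma>. \<sigma> \<in> P)" for P
  have \<iota>: "\<iota> (cauchy_class M d \<sigma>) = cauchy_class M d' \<sigma>" if \<sigma>: "X.MCauchy \<sigma>" for \<sigma>
  proof -
    define \<tau> where "\<tau> = (SOME \<tau>. \<tau> \<in> cauchy_class M d \<sigma>)"
    have "\<tau> \<in> cauchy_class M d \<sigma>"
      unfolding \<tau>_def by (rule someI[of _ \<sigma>]) (rule X.cauchy_class_self[OF \<sigma>])
    then have \<tau>: "X.MCauchy \<tau>" "(\<lambda>n. d (\<sigma> n) (\<tau> n)) \<longlonglongrightarrow> 0"
      by (auto simp: cauchy_class_def X.cauchy_rel_iff)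
    then have "(\<lambda>n. d' (\<sigma> n) (\<tau> n)) \<longlonglongrightarrow> 0"
      using null X.MCauchy_in_space \<sigma> by blast
    then show ?thesis
      using Y.cauchy_class_eq_iff[OF cauchy[OF \<sigma>] cauchy[OF \<tau>(1)]] by (simp add: \<iota>_def \<tau>_def)
  qed
  have "inj_on \<iota> (mcompletion M d)"
  proof (rule inj_onI)
    fix P Q assume "P \<in> mcompletion M d" "Q \<in> mcompletion M d" and eq: "\<iota> P = \<iota> Q"
    then obtain \<sigma> \<tau> where \<sigma>: "X.MCauchy \<sigma>" "P = cauchy_class M d \<sigma>" and \<tau>: "X.MCauchy \<tau>" "Q = cauchy_class M d \<tau>"
      by (auto simp: X.mcompletion_eq)
    have "(\<lambda>n. d' (\<sigma> n) (\<tau> n)) \<longlonglongrightarrow> 0"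
      using eq \<iota> \<sigma> \<tau> Y.cauchy_class_eq_iff[OF cauchy[OF \<sigma>(1)] cauchy[OF \<tau>(1)]] by simp
    then have "(\<lambda>n. d (\<sigma> n) (\<tau> n)) \<longlonglongrightarrow> 0"
      using null_back bounded[OF \<sigma>(1)] X.MCauchy_in_space \<sigma>(1) \<tau>(1) by blast
    then show "P = Q" using X.cauchy_class_eq_iff \<sigma> \<tau> by simp
  qed
  then have incl: "natural_inclusion M d d' \<iota>"
    using cauchy \<iota> by (simp add: natural_inclusion_def)
  have "\<forall>n::nat. \<exists>x\<in>M. real n < a x" using a(2) by blast
  \<comment> \<open>The class of this escaping sequence is the additional point.\<close>
  then obtain x where x: "\<And>n::nat. x n \<in> M" "\<And>n::nat. real n < a (x n)" by metis
  have x_inf: "filterlim (\<lambda>n. a (x n)) at_top sequentially"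
    by (rule filterlim_at_top_mono[OF filterlim_real_sequentially]) (simp add: x(2) less_imp_le)
  note x_cauchy = cauchy_infinity[OF x_inf x(1)]
  have "\<exists>!p. p \<in> mcompletion M d' - \<iota> ` mcompletion M d"
  proof (rule ex1I[of _ "cauchy_class M d' x"])
    have ne: "cauchy_class M d' x \<noteq> cauchy_class M d' \<sigma>" if \<sigma>: "X.MCauchy \<sigma>" for \<sigma>
    proof
      assume "cauchy_class M d' x = cauchy_class M d' \<sigma>"
      then have "(\<lambda>n. d' (\<sigma> n) (x n)) \<longlonglongrightarrow> 0"
        using Y.cauchy_class_eq_iff[OF x_cauchy cauchy[OF \<sigma>]] by (simp add: Y.commute)
      moreover obtain R where R: "\<forall>\<^sub>F n in sequentially. a (\<sigma> n) \<le> R" using bounded[OF \<sigma>] by blast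
      ultimately have "(\<lambda>n. d (\<sigma> n) (x n)) \<longlonglongrightarrow> 0"
        using null_back X.MCauchy_in_space[OF \<sigma>] x(1) by blast
      then have "\<forall>\<^sub>F n in sequentially. dist (d (\<sigma> n) (x n)) 0 < 1" by (rule tendstoD) simp
      moreover have "\<forall>\<^sub>F n in sequentially. R + 1 \<le> a (x n)"
        using x_inf by (simp add: filterlim_at_top)
      ultimately have "\<forall>\<^sub>F n in sequentially. False"
        using R
      proof eventually_elim
        case (elim n)
        then show ?case using a(1)[of "\<sigma> n" "x n"] X.MCauchy_in_space[OF \<sigma>] x(1) by fastforce
      qed
      then show False by simp
    qed
    have "cauchy_class M d' x \<notin> \<iota> ` mcompletion M d"
    proof
      assume "cauchy_class M d' x \<in> \<iota> ` mcompletion M d"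
      then obtain P where P: "P \<in> mcompletion M d" "cauchy_class M d' x = \<iota> P" by blast
      from P(1) obtain \<sigma> where \<sigma>: "X.MCauchy \<sigma>" "P = cauchy_class M d \<sigma>"
        by (auto simp: X.mcompletion_eq)
      show False using ne[OF \<sigma>(1)] P(2) \<iota>[OF \<sigma>(1)] \<sigma>(2) by simp
    qed
    moreover have "cauchy_class M d' x \<in> mcompletion M d'"
      unfolding Y.mcompletion_eq using x_cauchy by blast
    ultimately show "cauchy_class M d' x \<in> mcompletion M d' - \<iota> ` mcompletion M d"
      by (rule DiffI[rotated])
  next
    fix p assume p: "p \<in> mcompletion M d' - \<iota> ` mcompletion M d"
    then have "p \<in> cauchy_class M d' ` {\<sigma>. Y.MCauchy \<sigma>}"
      unfolding Y.mcompletion_eq by blast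
    then obtain \<tau> where \<tau>: "Y.MCauchy \<tau>" "p = cauchy_class M d' \<tau>" by blast
    have "\<not> X.MCauchy \<tau>"
    proof
      assume \<tau>': "X.MCauchy \<tau>"
      then have "cauchy_class M d \<tau> \<in> mcompletion M d"
        unfolding X.mcompletion_eq by blast
      then have "p \<in> \<iota> ` mcompletion M d"
        using \<iota>[OF \<tau>'] \<tau>(2) by (metis imageI)
      then show False using p by blast
    qed
    from equiv_infinity[OF dichotomy[OF \<tau>(1) this] x_inf Y.MCauchy_in_space[OF \<tau>(1)] x(1)]
    show "p = cauchy_class M d' x"
      using Y.cauchy_class_eq_iff[OF \<tau>(1) x_cauchy] \<tau>(2) by simp
  qed
  with incl show ?thesis by (intro exI[of _ \<iota>] conjI)
qed

section \<open>Estimates for the sphericalized metric\<close>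

lemma nn_integral_affine:
  fixes f :: "real \<Rightarrow> ennreal"
  assumes f: "f \<in> borel_measurable borel" and c: "c \<noteq> 0"
  shows "(\<integral>\<^sup>+ x. f (t + c * x) \<partial>lborel) = ennreal (1 / \<bar>c\<bar>) * (\<integral>\<^sup>+ x. f x \<partial>lborel)"
proof -
  have "ennreal (1 / \<bar>c\<bar>) * (\<integral>\<^sup>+ x. f x \<partial>lborel)
      = (ennreal (1 / \<bar>c\<bar>) * ennreal \<bar>c\<bar>) * (\<integral>\<^sup>+ x. f (t + c * x) \<partial>lborel)"
    using nn_integral_real_affine[OF f c, of t] by (simp add: mult.assoc)
  also have "ennreal (1 / \<bar>c\<bar>) * ennreal \<bar>c\<bar> = 1"
    using c by (simp add: ennreal_mult[symmetric])
  finally show ?thesis by simp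
qed

text \<open>
  The setting of the estimates: a positive 1-Lipschitz size function \<open>a\<close>, here the distance to a
  boundary point, and a weight that depends on it through a quasidecreasing function \<open>\<rho>\<close>.
\<close>

locale sphericalization = Metric_space M d for M :: "'a set" and d +
  fixes a :: "'a \<Rightarrow> real" and \<rho> :: "real \<Rightarrow> real" and K :: real
  assumes a_pos: "\<And>x. x \<in> M \<Longrightarrow> 0 < a x"
    and a_Lipschitz: "\<And>x y. x \<in> M \<Longrightarrow> y \<in> M \<Longrightarrow> \<bar>a x - a y\<bar> \<le> d x y"
    and \<rho>_pos: "\<And>t. 0 < t \<Longrightarrow> 0 < \<rho> t"
    and \<rho>_measurable: "\<rho> \<in> borel_measurable (restrict_space borel {0<..})"
    and K_ge_1: "1 \<le> K"
    and quasidecr: "\<And>s t. 0 < s \<Longrightarrow> s \<le> t \<Longrightarrow> \<rho> t \<le> K * \<rho> s"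
begin

abbreviation weight :: "'a \<Rightarrow> ennreal" where
  "weight z \<equiv> ennreal (\<rho> (a z))"

lemma weight_measurable: "weight \<in> borel_measurable metric_borel"
proof -
  have sub: "{U. openin mtopology U} \<subseteq> Pow M"
    using openin_subset by fastforce
  have "a \<in> borel_measurable metric_borel"
  proof (rule borel_measurableI)
    fix S :: "real set" assume S: "open S"
    have "\<exists>r>0. mball x r \<subseteq> {z \<in> M. a z \<in> S}" if x: "x \<in> M" "a x \<in> S" for x
    proof -
      obtain r where r: "r > 0" "ball (a x) r \<subseteq> S" using S x by (auto simp: open_contains_ball)
      have "mball x r \<subseteq> {z \<in> M. a z \<in> S}"
      proof
        fix z assume "z \<in> mball x r"
        then have z: "z \<in> M" "d x z < r" by auto
        then have "a z \<in> ball (a x) r" using a_Lipschitz[OF x(1) z(1)] by (simp add: dist_real_def)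
        then show "z \<in> {z \<in> M. a z \<in> S}" using r z by auto
      qed
      then show ?thesis using r by blast
    qed
    then have "openin mtopology {z \<in> M. a z \<in> S}"
      by (auto simp: openin_mtopology)
    moreover have "a -` S \<inter> space metric_borel = {z \<in> M. a z \<in> S}"
      using sub by (auto simp: space_measure_of)
    ultimately show "a -` S \<inter> space metric_borel \<in> sets metric_borel"
      using sub by (auto simp: sets_measure_of)
  qed
  then have "a \<in> metric_borel \<rightarrow>\<^sub>M restrict_space borel {0<..}"
    using a_pos sub by (intro measurable_restrict_space2) (auto simp: space_measure_of)
  then have "(\<lambda>z. \<rho> (a z)) \<in> borel_measurable metric_borel"
    by (rule measurable_compose[OF _ \<rho>_measurable])
  then show ?thesis by (rule measurable_compose) simp
qed

lemma dist_from_start_le: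
  assumes r: "rectifiable_curve M d \<gamma> s u" and l: "l \<in> {0..arc_length \<gamma> s u}"
  shows "a (arc_length_param d \<gamma> s u l) \<le> a (\<gamma> s) + l"
    and "a (\<gamma> s) - l \<le> a (arc_length_param d \<gamma> s u l)"
    and "a (\<gamma> u) - (arc_length \<gamma> s u - l) \<le> a (arc_length_param d \<gamma> s u l)"
proof -
  let ?L = "arc_length \<gamma> s u" and ?\<phi> = "arc_length_param d \<gamma> s u"
  have ends: "0 \<in> {0..?L}" "?L \<in> {0..?L}" using l by auto
  note L = arc_length_param_in_space[OF r] arc_length_param_Lipschitz[OF r] arc_length_param_endpoints[OF r]
  have "\<bar>a (?\<phi> l) - a (\<gamma> s)\<bar> \<le> l"
    using a_Lipschitz[of "?\<phi> l" "?\<phi> 0"] L(1)[OF l] L(1)[OF ends(1)] L(2)[OF l ends(1)] l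
    by (simp add: L(3))
  moreover have "\<bar>a (?\<phi> l) - a (\<gamma> u)\<bar> \<le> ?L - l"
    using a_Lipschitz[of "?\<phi> l" "?\<phi> ?L"] L(1)[OF l] L(1)[OF ends(2)] L(2)[OF l ends(2)] l
    by (simp add: L(4))
  ultimately show "a (?\<phi> l) \<le> a (\<gamma> s) + l" "a (\<gamma> s) - l \<le> a (?\<phi> l)" "a (\<gamma> u) - (?L - l) \<le> a (?\<phi> l)"
    by linarith+
qed

text \<open>
  On the initial piece of length \<open>\<delta>\<close> of a curve starting in \<open>x\<close> the size is at most \<open>a x + \<delta>\<close>,
  and therefore \<open>\<rho>\<close> is at least \<open>\<rho> (a x + \<delta>) / K\<close> there.
\<close>

lemma weighted_dist_ge:
  assumes x: "x \<in> M" and \<delta>: "0 \<le> \<delta>" "\<delta> \<le> d x y"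
  shows "ennreal (\<rho> (a x + \<delta>) / K * \<delta>) \<le> weighted_dist M d weight x y"
proof (rule weighted_dist_geI)
  fix \<gamma> s u assume r: "rectifiable_curve M d \<gamma> s u" and e: "\<gamma> s = x" "\<gamma> u = y"
  let ?L = "arc_length \<gamma> s u" and ?\<phi> = "arc_length_param d \<gamma> s u"
  let ?c = "\<rho> (a x + \<delta>) / K"
  have "\<delta> \<le> ?L" using dist_le_arc_length[OF r] e \<delta> by simp
  have c: "0 \<le> ?c" using \<rho>_pos[of "a x + \<delta>"] a_pos[OF x] \<delta> K_ge_1 by simp
  have "ennreal (?c * \<delta>) = (\<integral>\<^sup>+ l. ennreal ?c * indicator {0..\<delta>} l \<partial>lborel)"
    using \<delta>(1) by (simp add: nn_integral_cmult ennreal_mult[OF c \<delta>(1)] del: times_divide_eq_left)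
  also have "\<dots> \<le> curve_integral d weight \<gamma> s u"
    unfolding curve_integral_alt
  proof (rule nn_integral_mono)
    fix l
    show "ennreal ?c * indicator {0..\<delta>} l \<le> weight (?\<phi> l) * indicator {0..?L} l"
    proof (cases "l \<in> {0..\<delta>}")
      case True
      then have l: "l \<in> {0..?L}" using \<open>\<delta> \<le> ?L\<close> by auto
      have "\<rho> (a x + \<delta>) \<le> K * \<rho> (a (?\<phi> l))"
        using dist_from_start_le(1)[OF r l] True e a_pos arc_length_param_in_space[OF r l]
        by (intro quasidecr) auto
      then have "?c \<le> \<rho> (a (?\<phi> l))" using K_ge_1 by (simp add: pos_divide_le_eq mult.commute)
      then show ?thesis using l True by (simp add: ennreal_leI)
    qed simp
  qed
  finally show "ennreal (?c * \<delta>) \<le> curve_integral d weight \<gamma> s u" .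
qed

lemma curve_integral_le_length:
  assumes r: "rectifiable_curve M d \<gamma> s u" and B: "\<And>t. 0 < t \<Longrightarrow> \<rho> t \<le> B" "0 \<le> B"
  shows "curve_integral d weight \<gamma> s u \<le> ennreal (B * arc_length \<gamma> s u)"
proof -
  have "curve_integral d weight \<gamma> s u \<le> (\<integral>\<^sup>+ l. ennreal B * indicator {0..arc_length \<gamma> s u} l \<partial>lborel)"
    unfolding curve_integral_alt
    using B(1) a_pos arc_length_param_in_space[OF r]
    by (intro nn_integral_mono) (auto split: split_indicator intro!: ennreal_leI)
  also have "\<dots> = ennreal (B * arc_length \<gamma> s u)"
    using B by (simp add: nn_integral_cmult ennreal_mult arc_length_def)
  finally show ?thesis .
qed

definition tail :: "real \<Rightarrow> ennreal" where
  "tail R = (\<integral>\<^sup>+ t. ennreal (\<rho> t) * indicator {0<..} t * indicator {R..} t \<partial>lborel)"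

lemma radial_measurable: "(\<lambda>t. ennreal (\<rho> t) * indicator {0<..} t) \<in> borel_measurable borel"
proof -
  have "(\<lambda>t. ennreal (\<rho> t)) \<in> borel_measurable (restrict_space borel {0<..})"
    using \<rho>_measurable by measurable
  then show ?thesis
    by (simp add: borel_measurable_restrict_space_iff_ennreal)
qed

lemma tail_antimono: "R \<le> R' \<Longrightarrow> tail R' \<le> tail R"
  unfolding tail_def by (intro nn_integral_mono mult_left_mono) (auto split: split_indicator)

lemma tail_tendsto_0:
  assumes fin: "(\<integral>\<^sup>+ t \<in> {0<..}. ennreal (\<rho> t) \<partial>lborel) < \<infinity>"
  shows "((\<lambda>R. enn2real (tail R)) \<longlongrightarrow> 0) at_top"
proof -
  let ?g = "\<lambda>t. ennreal (\<rho> t) * indicator {0<..} t"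
  note [measurable] = radial_measurable
  have le: "tail R \<le> (\<integral>\<^sup>+ t. ?g t \<partial>lborel)" for R
    unfolding tail_def by (intro nn_integral_mono) (auto split: split_indicator)
  have lim: "(\<lambda>n. tail (real n)) \<longlonglongrightarrow> (\<integral>\<^sup>+ (t::real). 0 \<partial>lborel)"
    unfolding tail_def
  proof (rule nn_integral_dominated_convergence[where w = ?g])
    show "AE t in lborel. (\<lambda>n. ?g t * indicator {real n..} t) \<longlonglongrightarrow> 0"
    proof (rule AE_I2)
      fix t :: real
      obtain N where "t < real N" using reals_Archimedean2 by blast
      then have "\<forall>\<^sub>F n in sequentially. ?g t * indicator {real n..} t = 0"
        unfolding eventually_sequentially by (intro exI[of _ N]) auto
      then show "(\<lambda>n. ?g t * indicator {real n..} t) \<longlonglongrightarrow> 0" by (rule tendsto_eventually)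
    qed
  qed (use fin in \<open>auto split: split_indicator\<close>)
  show ?thesis
  proof (rule tendstoI)
    fix e :: real assume e: "e > 0"
    have "\<forall>\<^sub>F n in sequentially. tail (real n) < ennreal e"
      using order_tendstoD(2)[OF lim, of "ennreal e"] e by simp
    then obtain n where n: "tail (real n) < ennreal e" by (auto simp: eventually_sequentially)
    have "dist (enn2real (tail R)) 0 < e" if "R \<ge> real n" for R
    proof -
      have "tail R < ennreal e" using tail_antimono[OF that] n by simp
      then show ?thesis by (cases "tail R") (auto simp: ennreal_less_iff)
    qed
    then show "\<forall>\<^sub>F R in at_top. dist (enn2real (tail R)) 0 < e"
      unfolding eventually_at_top_linorder by blast
  qed
qed

text \<open>
  The hypothesis bounds the size \<open>a\<close> from below by a multiple of the distance along the curve to the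
  nearer end point.  Combined with the Lipschitz property of \<open>a\<close>, this
  bounds the weight at arc length \<open>l\<close> from an end point by a constant multiple of \<open>\<rho>\<close> at an affine
  function of \<open>l\<close>, whose integral is a tail of the integral of \<open>\<rho>\<close>.
\<close>

lemma curve_integral_le_tails:
  assumes r: "rectifiable_curve M d \<gamma> s u" and C: "1 \<le> C"
    and uniform: "\<And>l. l \<in> {0..arc_length \<gamma> s u} \<Longrightarrow>
      min l (arc_length \<gamma> s u - l) \<le> C * a (arc_length_param d \<gamma> s u l)"
  defines "k \<equiv> 1 / (2 * (1 + C))"
  shows "curve_integral d weight \<gamma> s u \<le> ennreal (2 * C * K) * (tail (k * a (\<gamma> s)) + tail (k * a (\<gamma> u)))"
proof -
  let ?L = "arc_length \<gamma> s u" and ?\<phi> = "arc_length_param d \<gamma> s u"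
  let ?p = "1 / (2 * C)"
  define q q' where "q = k * a (\<gamma> s)" and "q' = k * a (\<gamma> u)"
  define G where "G q t = ennreal (\<rho> t) * indicator {0<..} t * indicator {q..} t" for q t :: real
  have G [measurable]: "G q \<in> borel_measurable borel" for q
    unfolding G_def using radial_measurable by measurable
  have L0: "0 \<le> ?L" by (simp add: arc_length_def)
  have "\<gamma> s \<in> M" "\<gamma> u \<in> M" using rectifiable_curveD(1,2)[OF r] by auto
  then have qpos: "0 < q" "0 < q'" using a_pos C by (auto simp: q_def q'_def k_def)
  \<comment> \<open>Here m is the distance along the curve to the nearer end point and A the size of that end point:
    m <= C * a z and A - m <= a z give A <= (1 + C) * a z, and a z is at least the mean of
    m / C and A / (1 + C).\<close>
  have G_ge: "weight z \<le> ennreal K * G q (q + ?p * m)"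
    if z: "z \<in> M" and m: "0 \<le> m" "m \<le> C * a z" "A - m \<le> a z" and q: "q = k * A" "0 < q" for z m A q
  proof -
    have "A \<le> (1 + C) * a z" using m by (simp add: algebra_simps)
    then have "k * A \<le> k * ((1 + C) * a z)" using C by (intro mult_left_mono) (auto simp: k_def)
    also have "k * ((1 + C) * a z) = a z / 2" using C by (simp add: k_def divide_simps)
    finally have "q \<le> a z / 2" using q(1) by simp
    moreover have "?p * m \<le> a z / 2" using m(2) C by (simp add: field_simps)
    ultimately have "q + ?p * m \<le> a z" by simp
    moreover have "0 \<le> ?p * m" using m C by simp
    ultimately have "\<rho> (a z) \<le> K * \<rho> (q + ?p * m)" using q by (intro quasidecr) auto
    then have "weight z \<le> ennreal (K * \<rho> (q + ?p * m))" by (rule ennreal_leI)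
    also have "\<dots> = ennreal K * G q (q + ?p * m)"
      using K_ge_1 \<rho>_pos[of "q + ?p * m"] q \<open>0 \<le> ?p * m\<close> by (simp add: G_def ennreal_mult)
    finally show ?thesis .
  qed
  have "curve_integral d weight \<gamma> s u \<le>
      (\<integral>\<^sup>+ l. ennreal K * (G q (q + ?p * l) + G q' ((q' + ?p * ?L) + (- ?p) * l)) \<partial>lborel)"
    unfolding curve_integral_alt
  proof (rule nn_integral_mono)
    fix l
    show "weight (?\<phi> l) * indicator {0..?L} l
        \<le> ennreal K * (G q (q + ?p * l) + G q' ((q' + ?p * ?L) + (- ?p) * l))"
    proof (cases "l \<in> {0..?L}")
      case l: True
      note z = arc_length_param_in_space[OF r l] and D = dist_from_start_le[OF r l]
      have eq: "(q' + ?p * ?L) + (- ?p) * l = q' + ?p * (?L - l)" by (simp add: diff_divide_distrib)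
      have "weight (?\<phi> l) \<le> ennreal K * G q (q + ?p * l) \<or> weight (?\<phi> l) \<le> ennreal K * G q' (q' + ?p * (?L - l))"
      proof (cases "l \<le> ?L - l")
        case True
        then have "weight (?\<phi> l) \<le> ennreal K * G q (q + ?p * l)"
          using uniform[OF l] D l qpos by (intro G_ge[OF z, of l "a (\<gamma> s)"]) (auto simp: q_def)
        then show ?thesis ..
      next
        case False
        then have "weight (?\<phi> l) \<le> ennreal K * G q' (q' + ?p * (?L - l))"
          using uniform[OF l] D l qpos by (intro G_ge[OF z, of "?L - l" "a (\<gamma> u)"]) (auto simp: q'_def)
        then show ?thesis ..
      qed
      then show ?thesis
        unfolding eq distrib_left using l by (auto intro: add_increasing add_increasing2)
    qed simp
  qed
  also have "\<dots> = ennreal K * ((\<integral>\<^sup>+ l. G q (q + ?p * l) \<partial>lborel) + (\<integral>\<^sup>+ l. G q' ((q' + ?p * ?L) + (- ?p) * l) \<partial>lborel))"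
    by (simp add: nn_integral_cmult nn_integral_add)
  also have "(\<integral>\<^sup>+ l. G q (q + ?p * l) \<partial>lborel) = ennreal (2 * C) * tail q"
    using nn_integral_affine[OF G, of ?p q q] C by (simp add: tail_def G_def)
  also have "(\<integral>\<^sup>+ l. G q' ((q' + ?p * ?L) + (- ?p) * l) \<partial>lborel) = ennreal (2 * C) * tail q'"
    using nn_integral_affine[OF G, of "- ?p" q' "q' + ?p * ?L"] C by (simp add: tail_def G_def)
  also have "ennreal K * (ennreal (2 * C) * tail q + ennreal (2 * C) * tail q')
      = ennreal (2 * C * K) * (tail q + tail q')"
    using C K_ge_1 by (simp add: ennreal_mult distrib_left mult_ac)
  finally show ?thesis by (simp add: q_def q'_def)
qed

end

section \<open>The sphericalized metric of a uniform space\<close>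

text \<open>
  The uniformity condition expressed through the arc-length parametrization: \<open>l\<close> and \<open>L - l\<close> are
  the lengths of the two pieces into which the point at arc length \<open>l\<close> divides the curve.
\<close>

definition (in Metric_space) uniformly_joined :: "real \<Rightarrow> ('a \<Rightarrow> real) \<Rightarrow> 'a \<Rightarrow> 'a \<Rightarrow> bool" where
  "uniformly_joined C a x y \<longleftrightarrow> (\<exists>\<gamma> s u. rectifiable_curve M d \<gamma> s u \<and> \<gamma> s = x \<and> \<gamma> u = y
     \<and> arc_length \<gamma> s u \<le> C * d x y
     \<and> (\<forall>l\<in>{0..arc_length \<gamma> s u}. min l (arc_length \<gamma> s u - l) \<le> C * a (arc_length_param d \<gamma> s u l)))"

text \<open>
  The distance to the whole boundary is at most the distance to the single boundary point \<open>b\<close>, so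
  a uniform curve stays away from \<open>b\<close>.
\<close>

lemma (in Metric_space) uniform_metric_space_uniformly_joined:
  assumes uniform: "uniform_metric_space M d" and b: "b \<in> mboundary M d"
  obtains C where "1 \<le> C" "\<And>x y. x \<in> M \<Longrightarrow> y \<in> M \<Longrightarrow>
    uniformly_joined C (\<lambda>z. mcompletion_dist M d b (mcompletion_point M d z)) x y"
proof -
  let ?a = "\<lambda>z. mcompletion_dist M d b (mcompletion_point M d z)"
  obtain C where C: "1 \<le> C" and curves: "\<forall>x\<in>M. \<forall>y\<in>M. \<exists>\<gamma> s u.
      metric_curve M d \<gamma> s u \<and> \<gamma> s = x \<and> \<gamma> u = y \<and>
      curve_length d \<gamma> s u \<le> ennreal (C * d x y) \<and>
      (\<forall>t\<in>{s..u}. min (curve_length d \<gamma> s t) (curve_length d \<gamma> t u)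
        \<le> ennreal (C * mboundary_dist M d (\<gamma> t)))"
    using uniform unfolding uniform_metric_space_def by (elim conjE exE) (rule that)
  show thesis
  proof (rule that[OF C])
    fix x y assume xy: "x \<in> M" "y \<in> M"
    obtain \<gamma> s u where \<gamma>: "metric_curve M d \<gamma> s u" "\<gamma> s = x" "\<gamma> u = y"
      and len: "curve_length d \<gamma> s u \<le> ennreal (C * d x y)"
      and min: "\<forall>t\<in>{s..u}. min (curve_length d \<gamma> s t) (curve_length d \<gamma> t u)
        \<le> ennreal (C * mboundary_dist M d (\<gamma> t))"
      using curves[rule_format, OF xy] by (elim conjE exE) (rule that)
    have r: "rectifiable_curve M d \<gamma> s u"
      using \<gamma>(1) le_less_trans[OF len ennreal_less_top] by (simp add: rectifiable_curve_def)
    have len': "arc_length \<gamma> s u \<le> C * d x y"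
      unfolding arc_length_def using len C by (intro enn2real_leI) auto
    have min': "min l (arc_length \<gamma> s u - l) \<le> C * ?a (arc_length_param d \<gamma> s u l)"
      if l: "l \<in> {0..arc_length \<gamma> s u}" for l
    proof -
      obtain t where t: "t \<in> {s..u}" "arc_length \<gamma> s t = l" "arc_length_param d \<gamma> s u l = \<gamma> t"
        using arc_length_attained[OF r l] by metis
      have "\<gamma> t \<in> M" using rectifiable_curveD(2)[OF r] t(1) by auto
      note a = dist_from_boundary_point(1,4)[OF b this]
      have "ennreal (min l (arc_length \<gamma> s u - l)) = min (curve_length d \<gamma> s t) (curve_length d \<gamma> t u)"
        using arc_length_split(1,2)[OF r t(1)] t(2) l by (auto simp: min_def)
      also have "\<dots> \<le> ennreal (C * mboundary_dist M d (\<gamma> t))" using min t(1) by blast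
      also have "\<dots> \<le> ennreal (C * ?a (\<gamma> t))" using a(2) C by (intro ennreal_leI) simp
      finally show ?thesis using a(1) C t(3) by (subst (asm) ennreal_le_iff) auto
    qed
    show "uniformly_joined C ?a x y"
      unfolding uniformly_joined_def using r \<gamma>(2,3) len' min'
      by (intro exI[of _ \<gamma>] exI[of _ s] exI[of _ u] conjI ballI)
  qed
qed

context sphericalization
begin

text \<open>
  The bound \<open>2 * T 0\<close> for the new metric comes from the tail estimate, as \<open>T\<close> is decreasing and
  \<open>T 0\<close> is a multiple of the integral of \<open>\<rho>\<close>.
\<close>

lemma bounded_metric_with_one_point_complement:
  assumes unbdd: "\<And>R. \<exists>x\<in>M. R < a x"
    and C: "1 \<le> C"
    and uniform: "\<And>x y. x \<in> M \<Longrightarrow> y \<in> M \<Longrightarrow> uniformly_joined C a x y"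
    and fin: "(\<integral>\<^sup>+ t \<in> {0<..}. ennreal (\<rho> t) \<partial>lborel) < \<infinity>"
    and bdd: "bounded (\<rho> ` {0<..})"
  defines "d' \<equiv> \<lambda>x y. enn2real (weighted_dist M d weight x y)"
  shows "Metric_space M d'"
    and "Metric_space.mbounded M d' M"
    and "\<exists>\<iota>. natural_inclusion M d d' \<iota> \<and> (\<exists>!p. p \<in> mcompletion M d' - \<iota> ` mcompletion M d)"
proof -
  let ?W = "weighted_dist M d weight"
  obtain B where B: "0 < B" "\<And>t. 0 < t \<Longrightarrow> \<rho> t \<le> B"
    using bdd by (fastforce simp: bounded_pos abs_le_iff)
  have W_le: "?W x y \<le> ennreal (B * C * d x y)" if xy: "x \<in> M" "y \<in> M" for x y
  proof -
    obtain \<gamma> s u where \<gamma>: "rectifiable_curve M d \<gamma> s u" "\<gamma> s = x" "\<gamma> u = y" "arc_length \<gamma> s u \<le> C * d x y"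
      using uniform[OF xy] unfolding uniformly_joined_def by blast
    have "?W x y \<le> ennreal (B * arc_length \<gamma> s u)"
      using order_trans[OF weighted_dist_le[OF \<gamma>(1), of weight] curve_integral_le_length[OF \<gamma>(1), of B]] B \<gamma>(2,3)
      by simp
    also have "\<dots> \<le> ennreal (B * C * d x y)"
      using \<gamma>(4) B(1) by (intro ennreal_leI) (simp add: mult.assoc)
    finally show ?thesis .
  qed
  \<comment> \<open>In particular the infimum is finite, so its conversion to a real number loses nothing.\<close>
  then have W_eq: "?W x y = ennreal (d' x y)" if "x \<in> M" "y \<in> M" for x y
    using that le_less_trans[OF W_le ennreal_less_top] by (simp add: d'_def)
  have nonneg': "0 \<le> d' x y" for x y by (simp add: d'_def)
  have upper: "d' x y \<le> B * C * d x y" if "x \<in> M" "y \<in> M" for x y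
    using W_le[OF that] W_eq[OF that] B C by simp
  have ge: "\<rho> (a x + \<delta>) / K * \<delta> \<le> d' x y" if "x \<in> M" "y \<in> M" "0 \<le> \<delta>" "\<delta> \<le> d x y" for x y \<delta>
    using weighted_dist_ge[of x \<delta> y] W_eq[of x y] nonneg' that by simp
  show metric: "Metric_space M d'"
  proof
    show "d' x y = d' y x" for x y
      by (simp add: d'_def weighted_dist_commute[OF weight_measurable])
    fix x y assume x: "x \<in> M" and y: "y \<in> M"
    show "d' x y = 0 \<longleftrightarrow> x = y"
    proof
      assume "d' x y = 0"
      then have "\<rho> (a x + d x y) / K * d x y \<le> 0" using ge[OF x y nonneg order_refl] by simp
      moreover have "0 < \<rho> (a x + d x y) / K"
        using \<rho>_pos[of "a x + d x y"] a_pos[OF x] nonneg[of x y] K_ge_1 by simp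
      ultimately have "d x y \<le> 0" by (simp only: mult_le_0_iff) linarith
      then show "x = y" using x y nonneg[of x y] by simp
    qed (simp add: d'_def weighted_dist_refl y)
    fix z assume z: "z \<in> M"
    have "ennreal (d' x z) \<le> ennreal (d' x y + d' y z)"
      using weighted_dist_triangle[OF weight_measurable, of x z y] W_eq x y z nonneg' by simp
    then show "d' x z \<le> d' x y + d' y z"
      using nonneg' by (subst (asm) ennreal_le_iff) (auto intro: add_nonneg_nonneg)
  qed (simp add: d'_def)
  define k where "k = 1 / (2 * (1 + C))"
  have k: "k > 0" using C by (simp add: k_def)
  define T where "T R = 2 * C * K * enn2real (tail (k * R))" for R
  have tail_le: "tail R \<le> (\<integral>\<^sup>+ t \<in> {0<..}. ennreal (\<rho> t) \<partial>lborel)" for R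
    unfolding tail_def by (intro nn_integral_mono) (auto split: split_indicator)
  then have tail_fin: "tail R < top" for R
    using fin le_less_trans by fastforce
  have T: "d' x y \<le> T (a x) + T (a y)" if xy: "x \<in> M" "y \<in> M" for x y
  proof -
    obtain \<gamma> s u where \<gamma>: "rectifiable_curve M d \<gamma> s u" "\<gamma> s = x" "\<gamma> u = y"
      "\<And>l. l\<in>{0..arc_length \<gamma> s u} \<Longrightarrow> min l (arc_length \<gamma> s u - l) \<le> C * a (arc_length_param d \<gamma> s u l)"
      using uniform[OF xy] unfolding uniformly_joined_def by blast
    have "?W x y \<le> ennreal (2 * C * K) * (tail (k * a x) + tail (k * a y))"
      using order_trans[OF weighted_dist_le[OF \<gamma>(1), of weight] curve_integral_le_tails[OF \<gamma>(1) C \<gamma>(4)]] \<gamma>(2,3)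
      by (simp add: k_def)
    also have "\<dots> = ennreal (2 * C * K) * (ennreal (enn2real (tail (k * a x))) + ennreal (enn2real (tail (k * a y))))"
      using tail_fin by simp
    also have "\<dots> = ennreal (T (a x) + T (a y))"
      unfolding T_def distrib_left[symmetric]
      by (subst ennreal_plus[symmetric], simp, simp, subst ennreal_mult[symmetric]) (use C K_ge_1 in auto)
    finally have "ennreal (d' x y) \<le> ennreal (T (a x) + T (a y))"
      using W_eq[OF that] by simp
    moreover have "0 \<le> T R" for R using C K_ge_1 by (simp add: T_def)
    ultimately show ?thesis by (subst (asm) ennreal_le_iff) (auto intro: add_nonneg_nonneg)
  qed
  have T_le: "T (a x) \<le> T 0" if "x \<in> M" for x
  proof -
    have "tail (k * a x) \<le> tail (k * 0)" using k a_pos[OF that] by (intro tail_antimono) simp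
    then have "enn2real (tail (k * a x)) \<le> enn2real (tail (k * 0))"
      using tail_fin by (intro enn2real_mono) auto
    then show ?thesis unfolding T_def using C K_ge_1 by (intro mult_left_mono) auto
  qed
  have d'_le: "d' x y \<le> T 0 + T 0" if "x \<in> M" "y \<in> M" for x y
    using T[OF that] T_le[OF that(1)] T_le[OF that(2)] by linarith
  show "Metric_space.mbounded M d' M"
    unfolding Metric_space.mbounded_alt[OF metric]
    by (intro conjI exI[of _ "T 0 + T 0"] ballI d'_le order_refl)
  have T_lim: "(T \<longlongrightarrow> 0) at_top"
  proof -
    have "filterlim (\<lambda>R. k * R) at_top at_top"
      using k by (rule filterlim_tendsto_pos_mult_at_top[OF tendsto_const _ filterlim_ident])
    from filterlim_compose[OF tail_tendsto_0[OF fin] this] show ?thesis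
      unfolding T_def by (rule tendsto_mult_right_zero)
  qed
  have lower: "\<exists>c>0. \<forall>x\<in>M. \<forall>y\<in>M. a x \<le> R \<longrightarrow> c * min 1 (d x y) \<le> d' x y" for R
  proof (intro exI conjI ballI impI)
    \<comment> \<open>The maximum keeps the argument of \<open>\<rho>\<close> positive for negative bounds; the 1 is the largest \<open>?\<delta>\<close>.\<close>
    let ?R = "max R 0 + 1"
    show "0 < \<rho> ?R / K / K" using \<rho>_pos[of ?R] K_ge_1 by simp
    fix x y assume xy: "x \<in> M" "y \<in> M" "a x \<le> R"
    let ?\<delta> = "min 1 (d x y)"
    have "\<rho> ?R \<le> K * \<rho> (a x + ?\<delta>)"
      using a_pos[OF xy(1)] xy(3) nonneg[of x y] by (intro quasidecr) (auto simp: min_def intro: add_pos_nonneg)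
    then have "\<rho> ?R / K / K \<le> \<rho> (a x + ?\<delta>) / K"
      using K_ge_1 by (intro divide_right_mono) (auto simp: pos_divide_le_eq mult.commute)
    then have "\<rho> ?R / K / K * ?\<delta> \<le> \<rho> (a x + ?\<delta>) / K * ?\<delta>"
      using nonneg by (intro mult_right_mono) auto
    also have "\<dots> \<le> d' x y" using ge[OF xy(1,2), of ?\<delta>] nonneg by auto
    finally show "\<rho> ?R / K / K * ?\<delta> \<le> d' x y" .
  qed
  have "0 < B * C" using B C by simp
  from natural_inclusion_one_point_complement[where a = a and T = T, OF Metric_space_axioms metric this upper lower T T_lim a_Lipschitz unbdd]
  show "\<exists>\<iota>. natural_inclusion M d d' \<iota> \<and> (\<exists>!p. p \<in> mcompletion M d' - \<iota> ` mcompletion M d)" .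
qed

end

theorem theorem3p7:
  fixes M :: "'a set" and d :: "'a \<Rightarrow> 'a \<Rightarrow> real"
    and b :: "(nat \<Rightarrow> 'a) set" and \<rho> :: "real \<Rightarrow> real"
  assumes "uniform_metric_space M d"
    and "\<not> Metric_space.mbounded M d M"
    and "b \<in> mboundary M d"
    and "\<And>t. 0 < t \<Longrightarrow> 0 < \<rho> t"
    and "\<rho> \<in> borel_measurable (restrict_space borel {0<..})"
    and "(\<integral>\<^sup>+ t \<in> {0<..}. ennreal (\<rho> t) \<partial>lborel) < \<infinity>"
    and "quasidecreasing \<rho>"
    and "bounded (\<rho> ` {0<..})"
  shows "Metric_space M (spherical_dist M d b \<rho>)
    \<and> Metric_space.mbounded M (spherical_dist M d b \<rho>) M
    \<and> (\<exists>\<iota>. natural_inclusion M d (spherical_dist M d b \<rho>) \<iota>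
         \<and> (\<exists>!p. p \<in> mcompletion M (spherical_dist M d b \<rho>) - \<iota> ` mcompletion M d))"
proof -
  interpret Metric_space M d using assms(1) by (simp add: uniform_metric_space_def)
  define a where "a x = mcompletion_dist M d b (mcompletion_point M d x)" for x
  note a = dist_from_boundary_point[OF assms(3), folded a_def]
  obtain K where K: "1 \<le> K" "\<And>s t. 0 < s \<Longrightarrow> s \<le> t \<Longrightarrow> \<rho> t \<le> K * \<rho> s"
    using assms(7) by (auto simp: quasidecreasing_def)
  interpret sphericalization M d a \<rho> K
    using a(1,2) assms(4,5) K by unfold_locales
  obtain C where C: "1 \<le> C" "\<And>x y. x \<in> M \<Longrightarrow> y \<in> M \<Longrightarrow> uniformly_joined C a x y"
    using uniform_metric_space_uniformly_joined[OF assms(1,3)] unfolding a_def by metis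
  have unbounded: "\<exists>x\<in>M. R < a x" for R
  proof (rule ccontr)
    assume "\<not> (\<exists>x\<in>M. R < a x)"
    then have "a x \<le> R" if "x \<in> M" for x using that by force
    then have "d x y \<le> R + R" if "x \<in> M" "y \<in> M" for x y
      using a(3)[OF that] that by (meson add_mono order_trans)
    then show False using assms(2) mbounded_alt by blast
  qed
  have eq: "spherical_dist M d b \<rho> = (\<lambda>x y. enn2real (weighted_dist M d weight x y))"
    by (simp add: fun_eq_iff spherical_dist_def weighted_dist_def a_def)
  note main = bounded_metric_with_one_point_complement[OF unbounded C assms(6,8)]
  show ?thesis
    unfolding eq by (intro conjI main)
qed

end
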